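(* Let $p<1$ and $D\subset\mathbb{S}^n_-$. If $f\in L^{1}(D)$ is a nonnegative function, then there does not exist any complete, noncompact, strictly convex $C^2$-hypersurface $M\subset\mathbb{R}^{n+1}$ with spherical image $D$ satisfying $$H = (f K)^{\frac{1}{1-p}}\quad\text{on } D,$$ where $H$ is the support function and $K$ the Gauss curvature of $M$.
   Context: $\mathbb{S}^n$ is the unit sphere in $\mathbb{R}^{n+1}$ and $\mathbb{S}^n_-:=\{X\in\mathbb{S}^n : X_{n+1}<0\}$. The spherical image of a strictly convex hypersurface $M$ is the image $D\subset\mathbb{S}^n$ of its Gauss map (when $M$ is the graph of a convex function $u^*$, the normal at $(y,u^*(y))$ is $(Du^*,-1)/\sqrt{1+|Du^*|^2}$); for complete noncompact $M$ it is, after a suitable rotation, an open convex subset of $\mathbb{S}^n_-$. $M$ is parametrised by the inverse Gauss map $X:D\to M$, its support function is $H(\xi)=\langle \xi,X(\xi)\rangle$ for $\xi\in D$, and $K$ is regarded as a function on $D$. $L^1(D)$ is with respect to the spherical measure on $\mathbb{S}^n$. *)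

theory Defs
  imports "HOL-Analysis.Analysis"
begin

text \<open>
  Throughout, \<open>\<real>\<^sup>n\<^sup>+\<^sup>1\<close> is the Euclidean space \<open>(real^'n) \<times> real\<close> with \<open>n = CARD('n) \<ge> 1\<close> arbitrary;
  the last coordinate is \<open>snd\<close>. Notions that do not depend on this splitting are stated for an
  arbitrary Euclidean space.
\<close>

definition lower_hemisphere :: "((real^'n) \<times> real) set" where
  "lower_hemisphere = {X \<in> sphere 0 1. snd X < 0}"

text \<open>
  Spherical (surface) measure on the unit sphere, as a Borel measure on the ambient space that is
  concentrated on the sphere: the measure of \<open>A\<close> is the dimension of the ambient space times the
  Lebesgue measure of the cone \<open>{r \<xi> | \<xi> \<in> A, 0 < r < 1}\<close>.
\<close>

definition sphere_measure :: "'a::euclidean_space measure" where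
  "sphere_measure =
     scale_measure (of_nat DIM('a)) (distr (restrict_space lborel (ball 0 1)) borel sgn)"

lemma emeasure_sphere_measure:
  fixes A :: "'a::euclidean_space set"
  assumes "A \<in> sets borel"
  shows "emeasure sphere_measure A
           = of_nat DIM('a) * emeasure lborel {x \<in> ball 0 1. sgn x \<in> A}"
proof -
  have [measurable]: "sgn \<in> borel_measurable (borel :: 'a measure)"
    unfolding sgn_div_norm by measurable
  have m: "sgn \<in> measurable (restrict_space lborel (ball (0::'a) 1)) borel"
    by (intro measurable_restrict_space1) simp
  have eq: "sgn -` A \<inter> ball 0 1 = {x \<in> ball 0 1. sgn x \<in> A}"
    by auto
  have r: "emeasure (restrict_space lborel (ball 0 1)) {x \<in> ball 0 1. sgn x \<in> A}
             = emeasure lborel {x \<in> ball 0 1. sgn x \<in> A}"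
    by (rule emeasure_restrict_space) auto
  show ?thesis
    using assms r
    by (simp add: sphere_measure_def emeasure_distr[OF m] space_restrict_space eq del: mem_ball mem_ball_0)
qed

text \<open>
  \<open>g\<close> is a \<open>C\<^sup>2\<close> function on the open set \<open>U\<close> (with gradient \<open>G\<close> and Hessian \<open>G'\<close>) that cuts out
  \<open>M \<inter> U\<close> as a regular level set.
\<close>

definition local_defining_function ::
    "'a::euclidean_space set \<Rightarrow> 'a set \<Rightarrow> ('a \<Rightarrow> real) \<Rightarrow> bool" where
  "local_defining_function M U g \<longleftrightarrow>
     open U \<and> M \<inter> U = {x \<in> U. g x = 0} \<and>
     (\<exists>(G :: 'a \<Rightarrow> 'a) (G' :: 'a \<Rightarrow> 'a \<Rightarrow>\<^sub>L 'a).
        (\<forall>x\<in>U. (GDERIV g x :> G x) \<and> (G has_derivative blinfun_apply (G' x)) (at x)) \<and>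
        continuous_on U G' \<and>
        (\<forall>x\<in>M \<inter> U. G x \<noteq> 0))"

definition C2_hypersurface :: "'a::euclidean_space set \<Rightarrow> bool" where
  "C2_hypersurface M \<longleftrightarrow> (\<forall>x\<in>M. \<exists>U g. x \<in> U \<and> local_defining_function M U g)"

text \<open>The tangent hyperplane of \<open>M\<close> at \<open>x\<close> is the orthogonal complement of a unit normal.\<close>

definition unit_normal :: "'a::euclidean_space set \<Rightarrow> 'a \<Rightarrow> 'a \<Rightarrow> bool" where
  "unit_normal M x \<nu> \<longleftrightarrow> norm \<nu> = 1 \<and>
     (\<exists>U g c. x \<in> M \<inter> U \<and> local_defining_function M U g \<and> (GDERIV g x :> c *\<^sub>R \<nu>))"

text \<open>
  \<open>M\<close> lies on one side of each of its tangent hyperplanes and meets it in the point of tangency only.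
  Gauss curvature is allowed to vanish (as for the graph of \<open>|y|\<^sup>4\<close> at the origin).
\<close>

definition strictly_convex_hypersurface :: "'a::euclidean_space set \<Rightarrow> bool" where
  "strictly_convex_hypersurface M \<longleftrightarrow>
     (\<forall>x\<in>M. \<exists>\<nu>. unit_normal M x \<nu> \<and> (\<forall>y\<in>M - {x}. \<nu> \<bullet> (y - x) < 0))"

text \<open>
  Completeness refers to the distance on \<open>M\<close> given by the infimum of the lengths of paths inside
  \<open>M\<close> (on a hypersurface, the distance of the induced Riemannian metric), not to the ambient
  distance. Its value is \<open>\<infinity>\<close> for points not joined by a path of finite length.
\<close>

definition path_length :: "(real \<Rightarrow> 'a::euclidean_space) \<Rightarrow> ennreal" where
  "path_length \<gamma> =
     (SUP (N, t) \<in> {(N :: nat, t :: nat \<Rightarrow> real). mono t \<and> range t \<subseteq> {0..1}}.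
        ennreal (\<Sum>i<N. dist (\<gamma> (t i)) (\<gamma> (t (Suc i)))))"

definition intrinsic_dist :: "'a::euclidean_space set \<Rightarrow> 'a \<Rightarrow> 'a \<Rightarrow> ennreal" where
  "intrinsic_dist M x y =
     (INF \<gamma> \<in> {\<gamma>. path \<gamma> \<and> path_image \<gamma> \<subseteq> M \<and> pathstart \<gamma> = x \<and> pathfinish \<gamma> = y}. path_length \<gamma>)"

definition complete_hypersurface :: "'a::euclidean_space set \<Rightarrow> bool" where
  "complete_hypersurface M \<longleftrightarrow>
     (\<forall>X :: nat \<Rightarrow> 'a. range X \<subseteq> M \<longrightarrow>
        (\<forall>e>0. \<exists>N. \<forall>i\<ge>N. \<forall>j\<ge>N. intrinsic_dist M (X i) (X j) < e) \<longrightarrow>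
        (\<exists>x\<in>M. (\<lambda>i. intrinsic_dist M (X i) x) \<longlonglongrightarrow> 0))"

text \<open>
  Outer unit normal of a strictly convex hypersurface; for the graph of a convex function \<open>u\<close> it is
  \<open>(Du, -1) / sqrt (1 + |Du|\<^sup>2)\<close>.
\<close>

definition gauss_map :: "'a::euclidean_space set \<Rightarrow> 'a \<Rightarrow> 'a" where
  "gauss_map M x = (THE \<nu>. unit_normal M x \<nu> \<and> (\<forall>y\<in>M. \<nu> \<bullet> (y - x) \<le> 0))"

definition spherical_image :: "'a::euclidean_space set \<Rightarrow> 'a set" where
  "spherical_image M = gauss_map M ` M"

definition inverse_gauss_map :: "'a::euclidean_space set \<Rightarrow> 'a \<Rightarrow> 'a" where
  "inverse_gauss_map M = the_inv_into M (gauss_map M)"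

definition support_function :: "'a::euclidean_space set \<Rightarrow> 'a \<Rightarrow> real" where
  "support_function M \<xi> = \<xi> \<bullet> inverse_gauss_map M \<xi>"

text \<open>
  Gauss curvature at \<open>x \<in> M\<close>: the determinant of the differential of the Gauss map on the tangent
  space, computed in an orthonormal basis \<open>b\<close> of it. The derivative is taken within \<open>M\<close>, so \<open>A\<close> is
  determined on the tangent space only, which is all that enters the determinant.
\<close>

definition gauss_curvature :: "((real^'n) \<times> real) set \<Rightarrow> (real^'n) \<times> real \<Rightarrow> real" where
  "gauss_curvature M x =
     (THE k. \<exists>A (b :: 'n \<Rightarrow> (real^'n) \<times> real).
        (gauss_map M has_derivative A) (at x within M) \<and>
        (\<forall>i j. b i \<bullet> b j = (if i = j then 1 else 0)) \<and>
        (\<forall>i. b i \<bullet> gauss_map M x = 0) \<and>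
        k = det (\<chi> i j. b i \<bullet> A (b j)))"

end

theory Submission
  imports Defs
begin

text \<open>
  Suppose that such a hypersurface \<open>M\<close> exists. Write \<open>N\<close> for its Gauss map, \<open>K\<close> for its curvature and
  \<open>H = N x \<bullet> x\<close> for its support function, all regarded as functions on \<open>M\<close>. The equation gives \<open>H \<ge> 0\<close>
  and \<open>f(N) K = H\<^sup>1\<^sup>-\<^sup>p\<close>, so the substitution \<open>\<xi> = N x\<close>, whose Jacobian is \<open>K\<close>, would turn the integral of
  \<open>f\<close> over \<open>D\<close> into the integral of \<open>H\<^sup>1\<^sup>-\<^sup>p\<close> over \<open>M\<close>. The latter diverges: outside a vertical cylinder \<open>H\<close> is
  bounded below by a positive constant, and the part of \<open>M\<close> outside that cylinder has infinite area.

  \<^emph>\<open>The lower bound.\<close> Since \<open>N\<close> points into the lower hemisphere, \<open>M\<close> is the graph of a function \<open>u\<close> on an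
  open set \<open>\<Omega>\<close>, and strict convexity says that its tangent planes support the graph strictly. If \<open>u\<close>
  stayed bounded along a segment leaving \<open>\<Omega>\<close>, the lift of the segment to \<open>M\<close> would have finite length,
  against completeness (\<open>complete_graph_no_escape\<close>). Hence every point over which all tangent planes lie
  below a common height belongs to \<open>\<Omega>\<close> (\<open>mem_domI\<close>). This makes \<open>\<Omega>\<close> convex; and as \<open>H \<ge> 0\<close> says that
  no tangent plane passes above the origin, it also gives \<open>0 \<in> \<Omega>\<close> and \<open>u 0 \<le> 0\<close>. The height at which the
  tangent planes cross the vertical axis decreases as the point of tangency moves away from the axis, so
  these planes pass below the origin by a definite amount; where they are steep, a ball in \<open>\<Omega>\<close> keeps
  them away from the origin instead (\<open>legendre_bounded_below\<close>).

  \<^emph>\<open>The infinite area.\<close> Areas are replaced by volumes. Let \<open>x(\<xi>)\<close> be the point of \<open>M\<close> with normal \<open>\<xi>\<close>. For a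
  horizontal unit vector \<open>\<omega>\<close> and \<open>L > 0\<close> the map \<open>t\<xi> \<mapsto> x(\<xi>) + Lt\<omega>\<close> on the cone over a part of \<open>D\<close> has
  Jacobian \<open>L (\<omega> \<bullet> \<xi>) / (t\<^sup>n K)\<close> (\<open>sweep_derivative\<close>). Outside the cylinder \<open>1 / K\<close> is at most a constant
  times \<open>f\<close>, and in particular \<open>K \<noteq> 0\<close>, so that \<open>x(\<xi>)\<close> is differentiable there. Integrating over
  \<open>1/2 < t < 1\<close>, the image has volume at most \<open>CL\<close> with \<open>C\<close> independent of \<open>L\<close>, since spherical measure is
  defined through cones. On the other hand \<open>u\<close> is unbounded along some axis direction \<open>\<omega>\<close>, hence for every
  \<open>m\<close> the image contains a box of volume \<open>\<kappa>m (L/2 - S(m))\<close> as soon as \<open>L\<close> is large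
  (\<open>large_boxes_beyond_graph\<close>). Choosing first \<open>m\<close> and then \<open>L\<close> large contradicts the bound \<open>CL\<close>
  (\<open>curvature_density_not_integrable\<close>).
\<close>

section \<open>Complete graphs of strictly convex functions\<close>

lemma convex_on_if_subgradients:
  fixes u :: "'b::real_inner \<Rightarrow> real"
  assumes S: "convex S" and sub: "\<And>y y'. y \<in> S \<Longrightarrow> y' \<in> S \<Longrightarrow> u y + \<eta> y \<bullet> (y' - y) \<le> u y'"
  shows "convex_on S u"
proof (rule convex_onI[OF _ S])
  fix t x y assume *: "0 < t" "t < (1::real)" "x \<in> S" "y \<in> S"
  define w where "w = (1 - t) *\<^sub>R x + t *\<^sub>R y"
  have w: "w \<in> S" using S * by (auto simp: w_def convex_def)
  have "(1 - t) * (u w + \<eta> w \<bullet> (x - w)) + t * (u w + \<eta> w \<bullet> (y - w)) \<le> (1 - t) * u x + t * u y"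
    using sub[OF w *(3)] sub[OF w *(4)] * by (intro add_mono mult_left_mono) auto
  moreover have "(1 - t) * (u w + \<eta> w \<bullet> (x - w)) + t * (u w + \<eta> w \<bullet> (y - w))
      = u w + \<eta> w \<bullet> ((1 - t) *\<^sub>R x + t *\<^sub>R y - w)"
    by (simp add: algebra_simps inner_add_right inner_diff_right)
  ultimately show "u ((1 - t) *\<^sub>R x + t *\<^sub>R y) \<le> (1 - t) * u x + t * u y"
    by (simp add: w_def)
qed

text \<open>
  Continuity is local, and on a ball in \<open>S\<close> the supporting planes make \<open>u\<close> convex.
\<close>

lemma continuous_on_if_subgradients:
  fixes u :: "'b::euclidean_space \<Rightarrow> real"
  assumes S: "open S" and sub: "\<And>y y'. y \<in> S \<Longrightarrow> y' \<in> S \<Longrightarrow> u y + \<eta> y \<bullet> (y' - y) \<le> u y'"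
  shows "continuous_on S u"
proof (rule continuous_at_imp_continuous_on, rule ballI)
  fix y assume "y \<in> S"
  then obtain r where r: "r > 0" "ball y r \<subseteq> S" using S by (meson open_contains_ball)
  have "convex_on (ball y r) u"
    by (rule convex_on_if_subgradients[OF convex_ball sub]) (use r in blast)+
  then have "continuous_on (ball y r) u" by (intro convex_on_continuous) auto
  then show "isCont u y" using r by (simp add: continuous_on_eq_continuous_at)
qed

text \<open>
  A box around the axis spanned by \<open>b\<close>, of half-width \<open>e\<close> in the other coordinates; in the direction
  of \<open>b\<close> and of the last coordinate it is prescribed exactly, because these two extents will grow.
\<close>

lemma axis_box:
  fixes b :: "'b::euclidean_space" and l h e m Z :: real
  assumes b: "b \<in> Basis" and le: "l \<le> h" "0 \<le> e" "0 \<le> m"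
  obtains E :: "('b \<times> real) set" where "E \<in> sets borel"
    "emeasure lborel E = ennreal ((2 * e) ^ (DIM('b) - 1) * (h - l) * m)"
    "\<And>y z. (y, z) \<in> E \<Longrightarrow> l \<le> y \<bullet> b \<and> y \<bullet> b \<le> h \<and> z \<in> {Z..Z + m} \<and> norm (y - (y \<bullet> b) *\<^sub>R b) \<le> DIM('b) * e"
proof -
  define lo where "lo = (\<Sum>i\<in>Basis. (if i = b then l else - e) *\<^sub>R i)"
  define hi where "hi = (\<Sum>i\<in>Basis. (if i = b then h else e) *\<^sub>R i)"
  have lo: "lo \<bullet> i = (if i = b then l else - e)" and hi: "hi \<bullet> i = (if i = b then h else e)"
    if "i \<in> Basis" for i
    using that by (simp_all add: lo_def hi_def)
  define E where "E = cbox (lo, Z) (hi, Z + m)"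
  have ne: "cbox lo hi \<noteq> {}" using le by (auto simp: box_ne_empty lo hi)
  have "measure lborel E = measure lborel (cbox lo hi) * measure lborel (cbox Z (Z + m))"
    unfolding E_def by (rule content_Pair)
  also have "measure lborel (cbox lo hi) = (\<Prod>i\<in>Basis. hi \<bullet> i - lo \<bullet> i)"
    using ne by (rule content_cbox')
  also have "\<dots> = (h - l) * (\<Prod>i\<in>Basis - {b}. hi \<bullet> i - lo \<bullet> i)"
    using b by (subst prod.remove[of _ b]) (auto simp: lo hi)
  also have "(\<Prod>i\<in>Basis - {b}. hi \<bullet> i - lo \<bullet> i) = (\<Prod>i\<in>Basis - {b}. 2 * e)"
    by (rule prod.cong) (auto simp: lo hi)
  also have "\<dots> = (2 * e) ^ (DIM('b) - 1)" using b by (simp add: card_Diff_singleton)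
  also have "measure lborel (cbox Z (Z + m)) = m" using le by simp
  finally have m: "measure lborel E = (2 * e) ^ (DIM('b) - 1) * (h - l) * m" by simp
  have "emeasure lborel E = ennreal (measure lborel E)"
    unfolding E_def by (intro emeasure_eq_ennreal_measure) (use emeasure_lborel_cbox_finite[of "(lo, Z)" "(hi, Z + m)"] in auto)
  then have em: "emeasure lborel E = ennreal ((2 * e) ^ (DIM('b) - 1) * (h - l) * m)" by (simp add: m)
  have pt: "l \<le> y \<bullet> b \<and> y \<bullet> b \<le> h \<and> z \<in> {Z..Z + m} \<and> norm (y - (y \<bullet> b) *\<^sub>R b) \<le> DIM('b) * e"
    if "(y, z) \<in> E" for y z
  proof -
    have y: "y \<in> cbox lo hi" and z: "z \<in> cbox Z (Z + m)" using that by (auto simp: E_def cbox_Pair_eq)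
    have i: "lo \<bullet> i \<le> y \<bullet> i" "y \<bullet> i \<le> hi \<bullet> i" if "i \<in> Basis" for i using y that by (auto simp: mem_box)
    have "norm (y - (y \<bullet> b) *\<^sub>R b) \<le> (\<Sum>i\<in>Basis. \<bar>(y - (y \<bullet> b) *\<^sub>R b) \<bullet> i\<bar>)" by (rule norm_le_l1)
    also have "\<dots> \<le> (\<Sum>i\<in>(Basis::'b set). e)"
    proof (rule sum_mono)
      fix i :: 'b assume iB: "i \<in> Basis"
      show "\<bar>(y - (y \<bullet> b) *\<^sub>R b) \<bullet> i\<bar> \<le> e"
        using i[OF iB] lo[OF iB] hi[OF iB] b iB le by (auto simp: inner_diff_left inner_Basis abs_le_iff)
    qed
    finally show ?thesis using i[OF b] lo[OF b] hi[OF b] z by simp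
  qed
  show ?thesis by (rule that[OF _ em pt]) (simp add: E_def)
qed

text \<open>
  The graph of \<open>u\<close> as it is used below: \<open>\<eta> y\<close> is the gradient of \<open>u\<close> at \<open>y\<close>, but only its supporting
  property is recorded. \<open>no_escape\<close> is what completeness of the graph means for the domain, and
  \<open>tangent_at_0\<close> says that no tangent plane passes above the origin, i.e. that the support function
  is nonnegative. Convexity of \<open>\<Omega>\<close> is a consequence.
\<close>

locale complete_convex_graph =
  fixes \<Omega> :: "'b::euclidean_space set" and u :: "'b \<Rightarrow> real" and \<eta> :: "'b \<Rightarrow> 'b"
  assumes open_dom: "open \<Omega>"
    and dom_ne: "\<Omega> \<noteq> {}"
    and strict: "\<And>y y'. y \<in> \<Omega> \<Longrightarrow> y' \<in> \<Omega> \<Longrightarrow> y' \<noteq> y \<Longrightarrow> u y + \<eta> y \<bullet> (y' - y) < u y'"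
    and no_escape: "\<And>y d l C. 0 < l \<Longrightarrow> (\<And>s. 0 \<le> s \<Longrightarrow> s < l \<Longrightarrow> y + s *\<^sub>R d \<in> \<Omega>) \<Longrightarrow>
          (\<And>s. 0 \<le> s \<Longrightarrow> s < l \<Longrightarrow> u (y + s *\<^sub>R d) \<le> C) \<Longrightarrow> y + l *\<^sub>R d \<in> \<Omega>"
    and tangent_at_0: "\<And>y. y \<in> \<Omega> \<Longrightarrow> u y - \<eta> y \<bullet> y \<le> 0"
begin

lemma support: "y \<in> \<Omega> \<Longrightarrow> y' \<in> \<Omega> \<Longrightarrow> u y + \<eta> y \<bullet> (y' - y) \<le> u y'"
  using strict[of y y'] by (cases "y' = y") auto

lemma first_exit:
  assumes "y \<in> \<Omega>" "0 < l" "y + l *\<^sub>R d \<notin> \<Omega>"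
  obtains e where "0 < e" "e \<le> l" "y + e *\<^sub>R d \<notin> \<Omega>" "\<And>s. 0 \<le> s \<Longrightarrow> s < e \<Longrightarrow> y + s *\<^sub>R d \<in> \<Omega>"
proof -
  define A where "A = {0..l} \<inter> (\<lambda>s. y + s *\<^sub>R d) -` (- \<Omega>)"
  have "closed A"
    unfolding A_def using open_dom
    by (intro continuous_closed_preimage continuous_intros) (auto simp: closed_def)
  moreover have "l \<in> A" using assms by (auto simp: A_def)
  moreover have bb: "bdd_below A" by (auto simp: A_def intro!: bdd_belowI[of _ 0])
  ultimately have "Inf A \<in> A" using closed_contains_Inf[of A] by auto
  moreover have "Inf A \<noteq> 0" using \<open>Inf A \<in> A\<close> assms(1) by (auto simp: A_def)
  moreover have "y + s *\<^sub>R d \<in> \<Omega>" if "0 \<le> s" "s < Inf A" for s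
  proof (rule ccontr)
    assume "\<not> ?thesis"
    then have "s \<in> A" using that \<open>Inf A \<in> A\<close> by (auto simp: A_def)
    then show False using cInf_lower[OF _ bb] that by fastforce
  qed
  ultimately show ?thesis by (intro that[of "Inf A"]) (auto simp: A_def)
qed

text \<open>
  If \<open>q \<notin> \<Omega>\<close>, then on the segment from a point of \<open>\<Omega>\<close> to \<open>q\<close> the function \<open>u\<close> is unbounded before the
  first exit from \<open>\<Omega>\<close>. At a point where \<open>u\<close> exceeds both \<open>C\<close> and the initial value, \<open>u\<close> increases along the
  segment, so the tangent there lies above \<open>C\<close> at \<open>q\<close>.
\<close>

lemma mem_domI:
  assumes "\<And>y. y \<in> \<Omega> \<Longrightarrow> u y + \<eta> y \<bullet> (q - y) \<le> C"
  shows "q \<in> \<Omega>"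
proof (rule ccontr)
  assume q: "q \<notin> \<Omega>"
  obtain y where y: "y \<in> \<Omega>" using dom_ne by auto
  define d where "d = q - y"
  have "y + 1 *\<^sub>R d \<notin> \<Omega>" using q by (simp add: d_def)
  from first_exit[OF y _ this] obtain e where
    e: "0 < e" "e \<le> 1" "y + e *\<^sub>R d \<notin> \<Omega>" and inn: "\<And>s. 0 \<le> s \<Longrightarrow> s < e \<Longrightarrow> y + s *\<^sub>R d \<in> \<Omega>"
    by auto
  obtain s where s: "0 \<le> s" "s < e" "u (y + s *\<^sub>R d) > max C (u y)"
    using no_escape[OF e(1) inn, where C = "max C (u y)"] e(3) by (meson not_le)
  define x where "x = y + s *\<^sub>R d"
  have x: "x \<in> \<Omega>" using inn s by (simp add: x_def)
  have "u x + \<eta> x \<bullet> (y - x) \<le> u y" by (rule support[OF x y])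
  then have "s * (\<eta> x \<bullet> d) \<ge> u x - u y" by (simp add: x_def)
  then have "s * (\<eta> x \<bullet> d) > 0" using s by (auto simp: x_def)
  then have "\<eta> x \<bullet> d > 0" using s by (simp add: zero_less_mult_iff)
  moreover have "q - x = (1 - s) *\<^sub>R d" by (simp add: x_def d_def algebra_simps)
  ultimately have "\<eta> x \<bullet> (q - x) \<ge> 0" using s e by simp
  then show False using assms[OF x] s by (auto simp: x_def)
qed

text \<open>
  Over a convex combination of two points of the graph every tangent plane lies below the higher of
  the two points, because it does so over both.
\<close>

lemma convex_dom: "convex \<Omega>"
proof (rule convexI)
  fix x y and a b :: real
  assume *: "x \<in> \<Omega>" "y \<in> \<Omega>" "0 \<le> a" "0 \<le> b" "a + b = 1"
  show "a *\<^sub>R x + b *\<^sub>R y \<in> \<Omega>"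
  proof (rule mem_domI[where C = "max (u x) (u y)"])
    fix w assume w: "w \<in> \<Omega>"
    have "a *\<^sub>R x + b *\<^sub>R y - w = a *\<^sub>R (x - w) + b *\<^sub>R (y - w)"
      using *(5) by (simp add: algebra_simps flip: scaleR_add_left)
    then have "u w + \<eta> w \<bullet> (a *\<^sub>R x + b *\<^sub>R y - w)
        = (a + b) * u w + a * (\<eta> w \<bullet> (x - w)) + b * (\<eta> w \<bullet> (y - w))"
      using *(5) by (simp add: inner_add_right)
    also have "\<dots> = a * (u w + \<eta> w \<bullet> (x - w)) + b * (u w + \<eta> w \<bullet> (y - w))"
      by (simp add: algebra_simps)
    also have "\<dots> \<le> a * max (u x) (u y) + b * max (u x) (u y)"
      using support[OF w *(1)] support[OF w *(2)] * by (intro add_mono mult_left_mono) auto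
    also have "\<dots> = max (u x) (u y)" using *(5) by (simp flip: distrib_right)
    finally show "u w + \<eta> w \<bullet> (a *\<^sub>R x + b *\<^sub>R y - w) \<le> max (u x) (u y)" .
  qed
qed

lemma continuous_u: "continuous_on \<Omega> u"
  by (rule continuous_on_if_subgradients[OF open_dom support])

lemma zero_in_dom: "0 \<in> \<Omega>"
  using tangent_at_0 by (intro mem_domI[where C = 0]) (simp add: inner_diff_right)

lemma u_0_le: "u 0 \<le> 0"
  using tangent_at_0[OF zero_in_dom] by simp

text \<open>
  \<open>\<eta> y \<bullet> y - u y\<close> is the depth below the origin at which the tangent plane at \<open>y\<close> meets the vertical
  axis. By convexity this point moves down as \<open>y\<close> moves away from \<open>0\<close> along a ray.
\<close>

lemma legendre_mono:
  assumes "y \<in> \<Omega>" "y' \<in> \<Omega>" "y' = l *\<^sub>R y" "1 \<le> l"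
  shows "\<eta> y \<bullet> y - u y \<le> \<eta> y' \<bullet> y' - u y'"
proof (cases "l = 1")
  case False
  then have l: "l > 1" using assms by simp
  have 1: "u y + (l - 1) * (\<eta> y \<bullet> y) \<le> u y'"
    using support[OF assms(1,2)] assms(3) by (simp add: algebra_simps inner_diff_right)
  have 2: "u y' - (l - 1) * (\<eta> y' \<bullet> y) \<le> u y"
    using support[OF assms(2,1)] assms(3) by (simp add: algebra_simps inner_diff_right)
  have "(l - 1) * (\<eta> y \<bullet> y) \<le> (l - 1) * (\<eta> y' \<bullet> y)" using 1 2 by linarith
  then have "\<eta> y \<bullet> y \<le> \<eta> y' \<bullet> y" using l by simp
  moreover have "\<eta> y' \<bullet> y' - (l - 1) * (\<eta> y' \<bullet> y) = \<eta> y' \<bullet> y"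
    by (simp add: assms(3) algebra_simps)
  ultimately show ?thesis using 2 by linarith
qed (use assms in auto)

text \<open>
  Dividing the left and right sides by \<open>sqrt (1 + norm (\<eta> y)^2)\<close> gives a bound for the support function.
  Two estimates are combined. On the sphere of radius \<open>r\<close> the depth \<open>\<eta> y \<bullet> y - u y\<close> is positive, as the
  support at \<open>y\<close> is strict over \<open>0\<close> and \<open>u 0 \<le> 0\<close>; by compactness and monotonicity along rays it is at
  least some \<open>m > 0\<close> outside. And if \<open>u \<le> B\<close> on the ball, comparing with the point of the ball in the
  direction of \<open>\<eta> y\<close> gives at least \<open>r * norm (\<eta> y) - B\<close>.
\<close>

lemma legendre_bounded_below:
  assumes cont_grad: "continuous_on \<Omega> \<eta>" and r: "0 < r" "cball 0 r \<subseteq> \<Omega>"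
  obtains c where "0 < c"
    "\<And>y. y \<in> \<Omega> \<Longrightarrow> r \<le> norm y \<Longrightarrow> c * (1 + norm (\<eta> y)) \<le> \<eta> y \<bullet> y - u y"
proof -
  let ?h = "\<lambda>y. \<eta> y \<bullet> y - u y"
  have sub: "sphere 0 r \<subseteq> \<Omega>" using r by auto
  have hpos: "?h y > 0" if "y \<in> sphere 0 r" for y
  proof -
    have "u y + \<eta> y \<bullet> (0 - y) < u 0"
      using that r sub zero_in_dom by (intro strict) auto
    then show ?thesis using u_0_le by simp
  qed
  obtain b :: 'b where b: "b \<in> Basis" by (meson nonempty_Basis ex_in_conv)
  have "sphere (0::'b) r \<noteq> {}" using r by (auto intro!: exI[of _ "r *\<^sub>R b"] simp: b)
  moreover have "continuous_on (sphere 0 r) ?h"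
    by (intro continuous_intros continuous_on_subset[OF cont_grad sub] continuous_on_subset[OF continuous_u sub])
  ultimately obtain y0 where y0: "y0 \<in> sphere 0 r" "\<And>y. y \<in> sphere 0 r \<Longrightarrow> ?h y0 \<le> ?h y"
    using continuous_attains_inf[of "sphere 0 r" ?h] by auto
  define m where "m = ?h y0"
  have m: "m > 0" using hpos y0 by (simp add: m_def)
  have far: "m \<le> ?h y" if y: "y \<in> \<Omega>" "r \<le> norm y" for y
  proof -
    let ?y = "(r / norm y) *\<^sub>R y"
    have ny: "norm y > 0" using y r by linarith
    have s: "?y \<in> sphere 0 r" using ny r by auto
    have "m \<le> ?h ?y" unfolding m_def by (rule y0(2)[OF s])
    also have "\<dots> \<le> ?h y"
      using ny y r s sub by (intro legendre_mono[of ?y y "norm y / r"]) (auto simp: field_simps)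
    finally show ?thesis .
  qed
  have "continuous_on (cball 0 r) u" by (rule continuous_on_subset[OF continuous_u r(2)])
  then obtain B where B: "\<And>y. y \<in> cball 0 r \<Longrightarrow> u y \<le> B" "B \<ge> 0"
  proof -
    assume *: "continuous_on (cball 0 r) u" "\<And>B. (\<And>y. y \<in> cball 0 r \<Longrightarrow> u y \<le> B) \<Longrightarrow> 0 \<le> B \<Longrightarrow> thesis"
    have "bounded (u ` cball 0 r)" by (intro compact_imp_bounded compact_continuous_image *) auto
    then obtain B where "\<And>y. y \<in> cball 0 r \<Longrightarrow> \<bar>u y\<bar> \<le> B" by (fastforce simp: bounded_iff)
    then show thesis by (intro *(2)[of "max B 0"]) (fastforce simp: abs_le_iff)+
  qed
  have grad: "r * norm (\<eta> y) - B \<le> ?h y" if y: "y \<in> \<Omega>" for y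
  proof -
    let ?q = "r *\<^sub>R sgn (\<eta> y)"
    have q: "?q \<in> cball 0 r" using r by (auto simp: norm_sgn)
    have "u y + \<eta> y \<bullet> (?q - y) \<le> u ?q" using q r by (intro support[OF y]) auto
    moreover have "\<eta> y \<bullet> ?q = r * norm (\<eta> y)"
      by (cases "\<eta> y = 0") (simp_all add: sgn_div_norm dot_square_norm power2_eq_square)
    ultimately show ?thesis using B(1)[OF q] by (simp add: inner_diff_right del: inner_scaleR_right)
  qed
  \<comment> \<open>Both \<open>1\<close> and \<open>norm (\<eta> y)\<close> are multiples of the depth at most, by the bounds \<open>m\<close> and \<open>grad\<close>; \<open>c\<close> is
    the reciprocal of the sum of the two factors.\<close>
  define c where "c = inverse (1 / m + (1 + B / m) / r)"
  have k: "1 / m + (1 + B / m) / r > 0" using m r B(2) by (intro add_pos_nonneg) auto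
  show ?thesis
  proof
    show "0 < c" using k by (simp add: c_def)
    fix y assume y: "y \<in> \<Omega>" "r \<le> norm y"
    have 1: "1 \<le> ?h y / m" using far[OF y] m by simp
    then have "B \<le> B * (?h y / m)" using mult_left_mono[OF 1 B(2)] by simp
    then have "r * norm (\<eta> y) \<le> ?h y + B * (?h y / m)" using grad[OF y(1)] by linarith
    then have "norm (\<eta> y) \<le> (?h y + B * (?h y / m)) / r" using r by (simp add: field_simps)
    then have "1 + norm (\<eta> y) \<le> ?h y / m + (?h y + B * (?h y / m)) / r" using 1 by linarith
    also have "\<dots> = ?h y * (1 / m + (1 + B / m) / r)"
      using r m by (simp add: divide_simps) (simp add: algebra_simps)
    finally have "1 + norm (\<eta> y) \<le> ?h y * (1 / m + (1 + B / m) / r)" .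
    then show "c * (1 + norm (\<eta> y)) \<le> ?h y"
      using k unfolding c_def by (subst mult.commute) (simp add: pos_divide_le_eq flip: divide_inverse)
  qed
qed

text \<open>
  A function that has once increased along a ray keeps growing at least linearly, so it reaches every
  larger value within a bounded distance: \<open>no_escape\<close> rules out that the ray leaves \<open>\<Omega>\<close> before.
\<close>

lemma level_reached:
  assumes q: "q \<in> \<Omega>" "q + a *\<^sub>R \<omega> \<in> \<Omega>" and a: "0 < a" and g: "0 < g" "u q + g \<le> u (q + a *\<^sub>R \<omega>)"
    and z: "u (q + a *\<^sub>R \<omega>) \<le> z"
  obtains s where "a \<le> s" "s \<le> a * (1 + (z - u (q + a *\<^sub>R \<omega>)) / g)" "q + s *\<^sub>R \<omega> \<in> \<Omega>" "u (q + s *\<^sub>R \<omega>) = z"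
proof -
  define x where "x = q + a *\<^sub>R \<omega>"
  have x: "x \<in> \<Omega>" using q by (simp add: x_def)
  have slope: "\<eta> x \<bullet> \<omega> \<ge> g / a"
  proof -
    have "u x + \<eta> x \<bullet> (q - x) \<le> u q" by (rule support[OF x q(1)])
    then have "g \<le> a * (\<eta> x \<bullet> \<omega>)" using g by (simp add: x_def)
    then show ?thesis using a by (simp add: field_simps)
  qed
  have growth: "u x + (s - a) * (g / a) \<le> u (q + s *\<^sub>R \<omega>)" if "a \<le> s" "q + s *\<^sub>R \<omega> \<in> \<Omega>" for s
  proof -
    have eq: "q + s *\<^sub>R \<omega> - x = (s - a) *\<^sub>R \<omega>" by (simp add: x_def algebra_simps)
    have "(s - a) * (g / a) \<le> (s - a) * (\<eta> x \<bullet> \<omega>)" using slope that by (intro mult_left_mono) auto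
    then show ?thesis using support[OF x that(2)] unfolding eq by simp
  qed
  have bound: "s \<le> a * (1 + (z - u x) / g)" if "a \<le> s" "q + s *\<^sub>R \<omega> \<in> \<Omega>" "u (q + s *\<^sub>R \<omega>) \<le> z" for s
  proof -
    have "(s - a) * (g / a) \<le> z - u x" using growth[OF that(1,2)] that(3) by linarith
    then show ?thesis using a g by (simp add: field_simps)
  qed
  have line: "x + s *\<^sub>R \<omega> = q + (a + s) *\<^sub>R \<omega>" for s by (simp add: x_def algebra_simps)
  have "\<exists>s\<ge>0. x + s *\<^sub>R \<omega> \<in> \<Omega> \<and> z \<le> u (x + s *\<^sub>R \<omega>)"
  proof (rule ccontr)
    assume "\<not> ?thesis"
    then have low: "\<And>s. 0 \<le> s \<Longrightarrow> x + s *\<^sub>R \<omega> \<in> \<Omega> \<Longrightarrow> u (x + s *\<^sub>R \<omega>) < z" by force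
    define l where "l = a * (1 + (z - u x) / g) + 1"
    have l: "l > 0" using a g z by (auto simp: l_def x_def intro!: add_nonneg_pos)
    have "x + l *\<^sub>R \<omega> \<notin> \<Omega>"
      using bound[of "a + l"] low[of l] l a by (auto simp: line l_def)
    from first_exit[OF x l this] obtain e where
      e: "0 < e" "e \<le> l" "x + e *\<^sub>R \<omega> \<notin> \<Omega>" and inn: "\<And>s. 0 \<le> s \<Longrightarrow> s < e \<Longrightarrow> x + s *\<^sub>R \<omega> \<in> \<Omega>"
      by auto
    show False using no_escape[OF e(1) inn, where C = z] low[OF _ inn] e(3) by force
  qed
  then obtain s1 where s1: "0 \<le> s1" "x + s1 *\<^sub>R \<omega> \<in> \<Omega>" "z \<le> u (x + s1 *\<^sub>R \<omega>)" by auto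
  have seg: "x + s *\<^sub>R \<omega> \<in> \<Omega>" if s: "0 \<le> s" "s \<le> s1" for s
  proof (cases "s1 = 0")
    case False
    then have "x + s *\<^sub>R \<omega> = (1 - s / s1) *\<^sub>R x + (s / s1) *\<^sub>R (x + s1 *\<^sub>R \<omega>)"
      by (simp add: algebra_simps)
    then show ?thesis using convexD[OF convex_dom x s1(2), of "1 - s/s1" "s/s1"] s s1 False by auto
  qed (use that x in auto)
  have "continuous_on {0..s1} (\<lambda>s. u (x + s *\<^sub>R \<omega>))"
    by (rule continuous_on_compose2[OF continuous_u]) (auto intro!: continuous_intros seg)
  then obtain s where s: "0 \<le> s" "s \<le> s1" "u (x + s *\<^sub>R \<omega>) = z"
    using IVT'[of "\<lambda>s. u (x + s *\<^sub>R \<omega>)" 0 z s1] s1 z by (auto simp: x_def)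
  show ?thesis
  proof (rule that[of "a + s"])
    show "a + s \<le> a * (1 + (z - u (q + a *\<^sub>R \<omega>)) / g)"
      using s seg[OF s(1,2)] bound[of "a + s"] by (simp add: line flip: x_def)
  qed (use s seg[OF s(1,2)] in \<open>auto simp: line\<close>)
qed

text \<open>
  By strict convexity \<open>u\<close> exceeds \<open>u 0\<close> at one of two opposite points near \<open>0\<close>; by continuity the
  increase persists, uniformly, on parallel segments that start near \<open>0\<close>.
\<close>

lemma escaping_direction:
  assumes b: "b \<noteq> 0"
  obtains \<sigma> a g e where "\<sigma> = 1 \<or> \<sigma> = (-1::real)" "0 < a" "0 < g" "0 < e"
    "\<And>q. norm q \<le> e \<Longrightarrow> q \<in> \<Omega> \<and> q + a *\<^sub>R \<sigma> *\<^sub>R b \<in> \<Omega> \<and> u q + g \<le> u (q + a *\<^sub>R \<sigma> *\<^sub>R b) \<and>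
        u (q + a *\<^sub>R \<sigma> *\<^sub>R b) \<le> u (a *\<^sub>R \<sigma> *\<^sub>R b) + 1 \<and> u (a *\<^sub>R \<sigma> *\<^sub>R b) - 1 \<le> u (q + a *\<^sub>R \<sigma> *\<^sub>R b)"
proof -
  obtain d where d: "d > 0" "ball 0 d \<subseteq> \<Omega>" using open_dom zero_in_dom by (meson open_contains_ball)
  define a where "a = d / (2 * norm b)"
  have a: "a > 0" using d b by (simp add: a_def)
  have ab: "\<sigma> *\<^sub>R a *\<^sub>R b \<in> \<Omega>" if "\<bar>\<sigma>\<bar> = 1" for \<sigma> :: real
    using that d b a by (intro subsetD[OF d(2)]) (auto simp: a_def abs_mult)
  have "u (1 *\<^sub>R a *\<^sub>R b) > u 0 \<or> u ((-1) *\<^sub>R a *\<^sub>R b) > u 0"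
    using strict[OF zero_in_dom ab[of 1]] strict[OF zero_in_dom ab[of "-1"]] a b by auto
  then obtain \<sigma> :: real where \<sigma>: "\<sigma> = 1 \<or> \<sigma> = -1" "u (\<sigma> *\<^sub>R a *\<^sub>R b) > u 0" by blast
  define p where "p = a *\<^sub>R \<sigma> *\<^sub>R b"
  have p: "p \<in> \<Omega>" "u p > u 0" using ab[of \<sigma>] \<sigma> by (auto simp: p_def mult.commute)
  define g where "g = (u p - u 0) / 3"
  have g: "g > 0" using p by (simp add: g_def)
  have c0: "isCont u 0" "isCont u p"
    using continuous_u open_dom zero_in_dom p by (auto simp: continuous_on_eq_continuous_at)
  have "eventually (\<lambda>q. q \<in> \<Omega> \<and> dist (u q) (u 0) < g) (nhds 0)"
    using c0(1) g open_dom zero_in_dom unfolding isCont_def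
    by (intro eventually_conj eventually_nhds_in_open tendstoD)
       (auto simp: tendsto_at_iff_tendsto_nhds)
  moreover have "eventually (\<lambda>q. q \<in> \<Omega> \<and> dist (u q) (u p) < min g 1) (nhds p)"
    using c0(2) g open_dom p unfolding isCont_def
    by (intro eventually_conj eventually_nhds_in_open tendstoD)
       (auto simp: tendsto_at_iff_tendsto_nhds)
  ultimately obtain e1 e2 where e: "e1 > 0" "e2 > 0"
    "\<And>q. dist q 0 < e1 \<Longrightarrow> q \<in> \<Omega> \<and> dist (u q) (u 0) < g"
    "\<And>q. dist q p < e2 \<Longrightarrow> q \<in> \<Omega> \<and> dist (u q) (u p) < min g 1"
    unfolding eventually_nhds_metric by blast
  show ?thesis
  proof (rule that[of \<sigma> a g "min e1 e2 / 2"])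
    fix q :: 'b assume q: "norm q \<le> min e1 e2 / 2"
    have 1: "q \<in> \<Omega>" "dist (u q) (u 0) < g" using e(3)[of q] q e(1,2) by auto
    have 2: "q + p \<in> \<Omega>" "dist (u (q + p)) (u p) < min g 1"
      using e(4)[of "q + p"] q e(1,2) by (auto simp: dist_norm)
    have 3: "u p = u 0 + 3 * g" by (simp only: g_def) (simp add: field_simps)
    show "q \<in> \<Omega> \<and> q + a *\<^sub>R \<sigma> *\<^sub>R b \<in> \<Omega> \<and> u q + g \<le> u (q + a *\<^sub>R \<sigma> *\<^sub>R b) \<and>
        u (q + a *\<^sub>R \<sigma> *\<^sub>R b) \<le> u (a *\<^sub>R \<sigma> *\<^sub>R b) + 1 \<and> u (a *\<^sub>R \<sigma> *\<^sub>R b) - 1 \<le> u (q + a *\<^sub>R \<sigma> *\<^sub>R b)"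
      unfolding p_def[symmetric] using 1 2 3 by (auto simp: dist_real_def)
  qed (use \<sigma> a g e in auto)
qed

text \<open>
  Move the part of the graph outside the cylinder of radius \<open>r\<close> by distances between \<open>L/2\<close> and \<open>L\<close> in a
  direction \<open>\<omega>\<close> in which \<open>u\<close> grows. A line parallel to \<open>\<omega>\<close> that passes near the vertical axis at a height
  in \<open>{Z..Z + m}\<close> meets the graph at distance at most \<open>S\<close>, and so it is covered by the moving graph from
  \<open>S + L/2\<close> to \<open>L\<close>. These lines fill a box of length \<open>L/2 - S\<close> and height \<open>m\<close>.
\<close>

lemma large_boxes_beyond_graph:
  obtains r \<omega> \<kappa> where "0 < r" "cball 0 r \<subseteq> \<Omega>" "norm \<omega> = 1" "0 < \<kappa>"
    "\<And>m. 0 < m \<Longrightarrow> \<exists>S>0. \<forall>L\<ge>2 * S. \<exists>E\<in>sets borel. emeasure lborel E = ennreal (\<kappa> * m * (L / 2 - S)) \<and>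
        E \<subseteq> {(y + (L * t) *\<^sub>R \<omega>, u y) | y t. y \<in> \<Omega> \<and> r \<le> norm y \<and> 1/2 < t \<and> t < 1}"
proof -
  obtain b :: 'b where b: "b \<in> Basis" using nonempty_Basis by blast
  obtain \<sigma> a g e where \<sigma>: "\<sigma> = 1 \<or> \<sigma> = (-1::real)" and pos: "0 < a" "0 < g" "0 < e"
    and near: "\<And>q. norm q \<le> e \<Longrightarrow> q \<in> \<Omega> \<and> q + a *\<^sub>R \<sigma> *\<^sub>R b \<in> \<Omega> \<and> u q + g \<le> u (q + a *\<^sub>R \<sigma> *\<^sub>R b) \<and>
        u (q + a *\<^sub>R \<sigma> *\<^sub>R b) \<le> u (a *\<^sub>R \<sigma> *\<^sub>R b) + 1 \<and> u (a *\<^sub>R \<sigma> *\<^sub>R b) - 1 \<le> u (q + a *\<^sub>R \<sigma> *\<^sub>R b)"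
    using escaping_direction[of b] b by (metis nonzero_Basis)
  define \<omega> where "\<omega> = \<sigma> *\<^sub>R b"
  define r where "r = min a e"
  define Z where "Z = u (a *\<^sub>R \<omega>) + 1"
  define \<epsilon> where "\<epsilon> = e / DIM('b)"
  define \<kappa> where "\<kappa> = (2 * \<epsilon>) ^ (DIM('b) - 1)"
  have \<epsilon>: "\<epsilon> > 0" using pos by (simp add: \<epsilon>_def)
  have bb: "b \<bullet> b = 1" using b by simp
  have \<sigma>2: "\<sigma> * \<sigma> = 1" using \<sigma> by auto
  have "\<exists>S>0. \<forall>L\<ge>2 * S. \<exists>E\<in>sets borel. emeasure lborel E = ennreal (\<kappa> * m * (L / 2 - S)) \<and>
        E \<subseteq> {(y + (L * t) *\<^sub>R \<omega>, u y) | y t. y \<in> \<Omega> \<and> r \<le> norm y \<and> 1/2 < t \<and> t < 1}" if m: "m > 0" for m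
  proof -
    \<comment> \<open>\<open>m + 2\<close> bounds \<open>z - u (q + a *\<^sub>R \<omega>)\<close>, since \<open>u\<close> varies by at most \<open>1\<close> around \<open>a *\<^sub>R \<omega>\<close>.\<close>
    define s1 where "s1 = a * (1 + (m + 2) / g)"
    define S where "S = s1 + 1"
    have s1: "s1 > 0" using pos m by (auto simp: s1_def intro!: mult_pos_pos add_pos_pos)
    have "\<exists>E\<in>sets borel. emeasure lborel E = ennreal (\<kappa> * m * (L / 2 - S)) \<and>
        E \<subseteq> {(y + (L * t) *\<^sub>R \<omega>, u y) | y t. y \<in> \<Omega> \<and> r \<le> norm y \<and> 1/2 < t \<and> t < 1}" if L: "L \<ge> 2 * S" for L
    proof -
      define l where "l = (if \<sigma> = 1 then S + L / 2 else - L)"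
      define h where "h = (if \<sigma> = 1 then L else - (S + L / 2))"
      have hl: "h - l = L / 2 - S" by (simp add: h_def l_def)
      then have "l \<le> h" using L by linarith
      from axis_box[OF b this less_imp_le[OF \<epsilon>] less_imp_le[OF m], of Z]
      obtain E :: "('b \<times> real) set" where E: "E \<in> sets borel"
        "emeasure lborel E = ennreal ((2 * \<epsilon>) ^ (DIM('b) - 1) * (h - l) * m)"
        "\<And>y z. (y, z) \<in> E \<Longrightarrow> l \<le> y \<bullet> b \<and> y \<bullet> b \<le> h \<and> z \<in> {Z..Z + m} \<and> norm (y - (y \<bullet> b) *\<^sub>R b) \<le> DIM('b) * \<epsilon>"
        by blast
      have "\<exists>y t. (x, z) = (y + (L * t) *\<^sub>R \<omega>, u y) \<and> y \<in> \<Omega> \<and> r \<le> norm y \<and> 1/2 < t \<and> t < 1"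
        if xz: "(x, z) \<in> E" for x z
      proof -
        define \<tau> where "\<tau> = \<sigma> * (x \<bullet> b)"
        define q where "q = x - (x \<bullet> b) *\<^sub>R b"
        have x: "x = q + \<tau> *\<^sub>R \<omega>" using \<sigma>2 by (simp add: q_def \<tau>_def \<omega>_def)
        have \<tau>: "S + L / 2 \<le> \<tau>" "\<tau> \<le> L" using E(3)[OF xz] \<sigma> by (auto simp: l_def h_def \<tau>_def)
        have "norm q \<le> e" using E(3)[OF xz] by (simp add: q_def \<epsilon>_def)
        note q = near[OF this, folded \<omega>_def]
        have z: "Z \<le> z" "z \<le> Z + m" using E(3)[OF xz] by auto
        have uz: "u (q + a *\<^sub>R \<omega>) \<le> z" using q z by (simp add: Z_def)
        obtain s where s: "a \<le> s" "s \<le> a * (1 + (z - u (q + a *\<^sub>R \<omega>)) / g)" "q + s *\<^sub>R \<omega> \<in> \<Omega>" "u (q + s *\<^sub>R \<omega>) = z"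
          using level_reached[of q a \<omega> g z] q pos uz by blast
        have "(z - u (q + a *\<^sub>R \<omega>)) / g \<le> (m + 2) / g"
          using q z pos by (intro divide_right_mono) (auto simp: Z_def)
        then have "a * (1 + (z - u (q + a *\<^sub>R \<omega>)) / g) \<le> s1"
          unfolding s1_def using pos by (intro mult_left_mono) auto
        then have ss1: "s \<le> s1" using s by linarith
        have L0: "L > 0" using L s1 by (simp add: S_def)
        define t where "t = (\<tau> - s) / L"
        have Lt: "L * t = \<tau> - s" using L0 by (simp add: t_def)
        have t: "1/2 < t" "t < 1"
          using \<tau> ss1 s(1) pos(1) L0 by (auto simp: t_def S_def field_simps)
        have "(q + s *\<^sub>R \<omega>) \<bullet> \<omega> = s" using \<sigma>2 bb by (simp add: q_def \<omega>_def inner_diff_left algebra_simps)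
        moreover have "norm \<omega> = 1" using \<sigma> b by (auto simp: \<omega>_def)
        ultimately have "s \<le> norm (q + s *\<^sub>R \<omega>)" using norm_cauchy_schwarz[of "q + s *\<^sub>R \<omega>" \<omega>] by simp
        then have "r \<le> norm (q + s *\<^sub>R \<omega>)" using s(1) by (simp add: r_def)
        moreover have "x = q + s *\<^sub>R \<omega> + (L * t) *\<^sub>R \<omega>" by (simp add: Lt x algebra_simps)
        ultimately show ?thesis using s(3,4) t by blast
      qed
      then have "E \<subseteq> {(y + (L * t) *\<^sub>R \<omega>, u y) | y t. y \<in> \<Omega> \<and> r \<le> norm y \<and> 1/2 < t \<and> t < 1}" by auto
      moreover have "emeasure lborel E = ennreal (\<kappa> * m * (L / 2 - S))"
        using E(2) by (simp add: hl \<kappa>_def mult_ac)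
      ultimately show ?thesis using E(1) by blast
    qed
    then show ?thesis using s1 by (intro exI[of _ S]) (auto simp: S_def)
  qed
  moreover have "cball 0 r \<subseteq> \<Omega>" using near by (auto simp: r_def)
  moreover have "norm \<omega> = 1" using \<sigma> b by (auto simp: \<omega>_def)
  moreover have "\<kappa> > 0" using \<epsilon> by (simp add: \<kappa>_def)
  ultimately show ?thesis using that[of r \<omega> \<kappa>] pos by (auto simp: r_def)
qed

end

section \<open>Determinants in orthonormal families\<close>

text \<open>
  A well-ordered finite type with one element more than \<open>'n\<close>. Change of variables in the form of
  \<open>measure_differentiable_image\<close> is about spaces \<open>real^'m\<close> whose index type \<open>'m\<close> is well-ordered; with
  this index type it applies to \<open>(real^'n) \<times> real\<close>.
\<close>

typedef 'n idx = "{..CARD('n::finite)}" by auto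

instance idx :: (finite) finite
proof
  have "(UNIV :: 'a idx set) = Abs_idx ` {..CARD('a)}"
    using type_definition.Abs_image[OF type_definition_idx[where 'n='a]] by (rule sym)
  then show "finite (UNIV :: 'a idx set)" by (metis (no_types) finite_atMost finite_imageI)
qed

instantiation idx :: (finite) wellorder
begin
definition less_eq_idx :: "'a idx \<Rightarrow> 'a idx \<Rightarrow> bool" where
  "less_eq_idx x y \<longleftrightarrow> Rep_idx x \<le> Rep_idx y"
definition less_idx :: "'a idx \<Rightarrow> 'a idx \<Rightarrow> bool" where
  "less_idx x y \<longleftrightarrow> Rep_idx x < Rep_idx y"
instance
proof
  fix P and a :: "'a idx"
  assume *: "\<And>x::'a idx. (\<And>y. y < x \<Longrightarrow> P y) \<Longrightarrow> P x"
  show "P a"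
    by (induction "Rep_idx a" arbitrary: a rule: less_induct) (metis * less_idx_def)
qed (auto simp: less_eq_idx_def less_idx_def Rep_idx_inject)
end

lemma card_idx: "CARD('n::finite idx) = Suc CARD('n)"
  using type_definition.card[OF type_definition_idx[where 'n='n]] by simp

lemma idx_split:
  obtains h :: "'n::finite \<Rightarrow> 'n idx" and k where "inj h" "UNIV = insert k (range h)" "k \<notin> range h"
proof -
  obtain k :: "'n idx" where True by blast
  have "card (UNIV - {k}) = CARD('n)" by (simp add: card_idx card_Diff_singleton)
  then obtain h where "bij_betw h (UNIV :: 'n set) (UNIV - {k})"
    by (metis finite_same_card_bij finite)
  then show ?thesis by (intro that[of h k]) (auto simp: bij_betw_def)
qed

text \<open>
  Only permutations that fix \<open>k\<close> contribute to the determinant, and they are the extensions by \<open>k\<close> of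
  permutations of the remaining indices, with the same sign.
\<close>

lemma det_block:
  fixes A :: "'a::comm_ring_1^'m^'m" and h :: "'n::finite \<Rightarrow> 'm::finite"
  assumes h: "inj h" "UNIV = insert k (range h)" "k \<notin> range h"
    and z: "\<And>i. A $ k $ h i = 0"
  shows "det A = A $ k $ k * det (\<chi> i j. A $ h i $ h j)"
proof -
  let ?ih = "inv_into UNIV h"
  define ext where "ext p = (\<lambda>x. if x = k then k else h (p (?ih x)))" for p
  have ih: "?ih (h i) = i" for i using h(1) by simp
  have hk: "h i \<noteq> k" for i using h(3) by auto
  have ext_k: "ext p k = k" and ext_h: "ext p (h i) = h (p i)" for p i
    by (auto simp: ext_def ih hk)
  have bij_h: "bij_betw h UNIV (range h)" using h(1) by (simp add: bij_betw_def)
  have ext_alt: "ext p = (\<lambda>x. if x \<in> range h then h (p (?ih x)) else x)" for p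
    using h by (auto simp: ext_def fun_eq_iff)
  have perm: "ext p permutes range h" if "p permutes UNIV" for p
    unfolding ext_alt by (rule permutes_bij_inv_into[OF that bij_h])
  have sgn: "sign (ext p) = sign p" if "p permutes UNIV" for p :: "'n \<Rightarrow> 'n"
  proof -
    have "inj_on h UNIV" using h(1) .
    show ?thesis using that finite[of UNIV]
    proof (induction p rule: permutes_induct)
      case id
      have "ext id = id" using h by (auto simp: ext_alt fun_eq_iff f_inv_into_f)
      then show ?case by (simp add: id_def)
    next
      case (swap a b p)
      have e: "ext (Transposition.transpose a b \<circ> p) = Transposition.transpose (h a) (h b) \<circ> ext p"
      proof
        fix x
        consider "x = k" | i where "x = h i" using h(2) by blast
        then show "ext (Transposition.transpose a b \<circ> p) x = (Transposition.transpose (h a) (h b) \<circ> ext p) x"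
          using h(1) hk[THEN not_sym] by cases (auto simp: ext_k ext_h Transposition.transpose_def inj_eq)
      qed
      have pp: "permutation (ext p)" by (rule permutes_imp_permutation[OF _ perm[OF \<open>p permutes UNIV\<close>]]) simp
      have pn: "permutation p" by (rule permutes_imp_permutation[OF _ \<open>p permutes UNIV\<close>]) simp
      have "sign (ext (Transposition.transpose a b \<circ> p)) = sign (Transposition.transpose (h a) (h b)) * sign (ext p)"
        unfolding e by (rule sign_compose[OF permutation_swap_id pp])
      also have "\<dots> = sign (Transposition.transpose a b) * sign p"
        using swap h(1) by (simp add: sign_swap_id inj_eq)
      also have "\<dots> = sign (Transposition.transpose a b \<circ> p)"
        by (rule sign_compose[OF permutation_swap_id pn, symmetric])
      finally show ?case .
    qed
  qed
  have bij: "bij_betw ext {p. p permutes (UNIV::'n set)} {p. p permutes range h}"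
  proof -
    have "bij_betw (\<lambda>p x. if x \<in> range h then h (p (?ih x)) else x)
       {p. p permutes (UNIV::'n set)} {p. p permutes range h}"
      by (rule bij_betw_permutations[OF bij_h])
    then show ?thesis by (simp add: ext_alt[abs_def])
  qed
  let ?t = "\<lambda>p. of_int (sign p) * (\<Prod>i\<in>UNIV. A $ i $ p i)"
  have zero: "?t p = 0" if p: "p \<in> {p. p permutes UNIV} - {p. p permutes range h}" for p
  proof -
    have "p k \<noteq> k"
    proof
      assume "p k = k"
      then have "p permutes (UNIV - {k})" using p
        by (auto intro: permutes_superset[where S = UNIV])
      moreover have "UNIV - {k} = range h" using h by auto
      ultimately show False using p by simp
    qed
    then obtain i where "p k = h i" using h(2) by blast
    then have "A $ k $ p k = 0" using z by simp
    then show ?thesis by (metis (mono_tags, lifting) UNIV_I finite mult_zero_right prod_zero)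
  qed
  have "det A = sum ?t {p. p permutes UNIV}" by (simp add: det_def)
  also have "\<dots> = sum ?t {p. p permutes range h}"
    by (rule sum.mono_neutral_right) (use zero in \<open>auto intro: permutes_subset simp: finite_permutations\<close>)
  also have "\<dots> = (\<Sum>p | p permutes UNIV. ?t (ext p))"
    by (rule sum.reindex_bij_betw[OF bij, symmetric])
  also have "\<dots> = (\<Sum>p | p permutes UNIV. A $ k $ k * (of_int (sign p) * (\<Prod>i\<in>UNIV. A $ h i $ h (p i))))"
  proof (rule sum.cong[OF refl])
    fix p :: "'n \<Rightarrow> 'n" assume "p \<in> {p. p permutes UNIV}"
    then have s: "sign (ext p) = sign p" using sgn by auto
    have "(\<Prod>i\<in>UNIV. A $ i $ ext p i) = A $ k $ k * (\<Prod>i\<in>range h. A $ i $ ext p i)"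
      using h(3) by (subst h(2)) (simp add: ext_k)
    also have "(\<Prod>i\<in>range h. A $ i $ ext p i) = (\<Prod>i\<in>UNIV. A $ h i $ h (p i))"
      using h(1) by (simp add: prod.reindex ext_h)
    finally show "?t (ext p) = A $ k $ k * (of_int (sign p) * (\<Prod>i\<in>UNIV. A $ h i $ h (p i)))"
      by (simp add: s mult_ac)
  qed
  also have "\<dots> = A $ k $ k * det (\<chi> i j. A $ h i $ h j)"
    by (simp add: det_def sum_distrib_left)
  finally show ?thesis .
qed

definition orthonormal :: "('i \<Rightarrow> 'a::real_inner) \<Rightarrow> bool" where
  "orthonormal b \<longleftrightarrow> (\<forall>i j. b i \<bullet> b j = (if i = j then 1 else 0))"

lemma orthonormal_expansion:
  fixes b :: "'i::finite \<Rightarrow> 'a::euclidean_space"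
  assumes b: "orthonormal b" and x: "x \<in> span (range b)"
  shows "x = (\<Sum>i\<in>UNIV. (x \<bullet> b i) *\<^sub>R b i)"
  using x
proof (induction rule: span_induct_alt)
  case base then show ?case by simp
next
  case (step c y z)
  then obtain k where k: "y = b k" by auto
  have "(\<Sum>i\<in>UNIV. (y \<bullet> b i) *\<^sub>R b i) = y"
    using b by (simp add: k orthonormal_def if_distrib[of "\<lambda>r. r *\<^sub>R _"] cong: if_cong)
  then show ?case using step
    by (simp add: inner_add_left scaleR_add_left sum.distrib flip: scaleR_scaleR scaleR_sum_right)
qed

text \<open>
  The values of \<open>L\<close> may leave the span of the family: only the bilinear form \<open>(x, y) \<mapsto> x \<bullet> L y\<close> on the span
  enters. This is why a determinant taken on a tangent space does not depend on the orthonormal basis.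
\<close>

lemma det_orthonormal_change:
  fixes b c :: "'i::finite \<Rightarrow> 'a::euclidean_space"
  assumes b: "orthonormal b" and c: "orthonormal c" and sp: "\<And>i. c i \<in> span (range b)" and L: "linear L"
  shows "det (\<chi> i j. c i \<bullet> L (c j)) = det (\<chi> i j. b i \<bullet> L (b j))"
proof -
  define U :: "real^'i^'i" where "U = (\<chi> i k. c i \<bullet> b k)"
  have ex: "c i = (\<Sum>k\<in>UNIV. (c i \<bullet> b k) *\<^sub>R b k)" for i
    by (rule orthonormal_expansion[OF b sp])
  have UU: "U ** transpose U = mat 1"
  proof -
    have "(\<Sum>k\<in>UNIV. (c i \<bullet> b k) * (c j \<bullet> b k)) = c i \<bullet> c j" for i j
      by (subst (3) ex) (simp add: inner_sum_left inner_commute[of "b _"] mult.commute)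
    then show ?thesis using c
      by (simp add: U_def vec_eq_iff matrix_matrix_mult_def transpose_def mat_def orthonormal_def)
  qed
  have "(\<chi> i j. c i \<bullet> L (c j)) = U ** (\<chi> i j. b i \<bullet> L (b j)) ** transpose U"
  proof -
    have "c i \<bullet> L (c j) = (\<Sum>l\<in>UNIV. (\<Sum>k\<in>UNIV. (c i \<bullet> b k) * (b k \<bullet> L (b l))) * (c j \<bullet> b l))" for i j
    proof -
      have "c i \<bullet> L (c j) = c i \<bullet> (\<Sum>l\<in>UNIV. (c j \<bullet> b l) *\<^sub>R L (b l))"
        by (subst (2) ex) (simp add: linear_sum[OF L] linear_scale[OF L])
      also have "\<dots> = (\<Sum>l\<in>UNIV. (c i \<bullet> L (b l)) * (c j \<bullet> b l))"
        by (simp add: inner_sum_right mult.commute)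
      also have "\<dots> = (\<Sum>l\<in>UNIV. (\<Sum>k\<in>UNIV. (c i \<bullet> b k) * (b k \<bullet> L (b l))) * (c j \<bullet> b l))"
        by (subst ex) (simp add: inner_sum_left)
      finally show ?thesis .
    qed
    then show ?thesis
      by (simp add: U_def vec_eq_iff matrix_matrix_mult_def transpose_def)
  qed
  moreover have "det U * det U = 1"
    using arg_cong[OF UU, of det] by (simp add: det_mul det_I)
  ultimately show ?thesis by (simp add: det_mul mult.commute mult.left_commute)
qed

text \<open>
  In the orthonormal basis consisting of \<open>\<xi>\<close> and the \<open>b i\<close> the matrix of \<open>L\<close> is block triangular.
\<close>

lemma det_orthonormal_block:
  fixes \<beta> :: "'n::finite idx \<Rightarrow> 'a::euclidean_space" and b :: "'n \<Rightarrow> 'a"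
  assumes \<beta>: "bij_betw \<beta> UNIV Basis" and b: "orthonormal b"
    and \<xi>: "norm \<xi> = 1" "\<And>i. b i \<bullet> \<xi> = 0"
    and L: "linear L" "\<And>i. \<xi> \<bullet> L (b i) = 0"
  shows "det (\<chi> i j. \<beta> i \<bullet> L (\<beta> j)) = (\<xi> \<bullet> L \<xi>) * det (\<chi> i j. b i \<bullet> L (b j))"
proof -
  obtain h :: "'n \<Rightarrow> 'n idx" and k where h: "inj h" "UNIV = insert k (range h)" "k \<notin> range h"
    by (rule idx_split)
  define \<gamma> where "\<gamma> x = (if x = k then \<xi> else b (inv h x))" for x
  have hk: "h i \<noteq> k" for i using h(3) by auto
  have \<xi>b: "\<xi> \<bullet> b i = 0" for i using \<xi>(2)[of i] by (simp add: inner_commute)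
  have \<gamma>: "\<gamma> k = \<xi>" "\<gamma> (h i) = b i" for i by (auto simp: \<gamma>_def hk h(1))
  have "orthonormal \<gamma>"
    unfolding orthonormal_def
  proof (intro allI)
    fix x y
    have c: "z = k \<or> (\<exists>i. z = h i)" for z using h(2) by blast
    show "\<gamma> x \<bullet> \<gamma> y = (if x = y then 1 else 0)"
      using c[of x] c[of y] \<xi>(2) b h(1) hk[THEN not_sym] hk \<xi>(1)[unfolded norm_eq_1]
      by (auto simp: \<gamma> orthonormal_def inj_eq \<xi>b)
  qed
  moreover have "orthonormal \<beta>"
    using \<beta> by (auto simp: orthonormal_def bij_betw_def inj_eq intro!: inner_same_Basis inner_not_same_Basis)
  moreover have "range \<beta> = Basis" using \<beta> by (simp add: bij_betw_def)
  ultimately have "det (\<chi> i j. \<beta> i \<bullet> L (\<beta> j)) = det (\<chi> i j. \<gamma> i \<bullet> L (\<gamma> j))"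
    using det_orthonormal_change[of \<beta> \<gamma> L] L(1) by simp
  also have "\<dots> = (\<xi> \<bullet> L \<xi>) * det (\<chi> i j. b i \<bullet> L (b j))"
    using det_block[OF h, of "\<chi> i j. \<gamma> i \<bullet> L (\<gamma> j)"] L(2) by (simp add: \<gamma>)
  finally show ?thesis .
qed

section \<open>Volume bounds for images of differentiable maps\<close>

text \<open>
  The null sets of the image measure pull back to null sets, so that completing commutes with taking
  image measures.
\<close>

lemma completion_distr:
  assumes T: "T \<in> measurable M N"
  shows "T \<in> measurable (completion M) (completion (distr M N T))"
    and "completion (distr M N T) = distr (completion M) (completion (distr M N T)) T"
proof -
  let ?D = "distr M N T"
  have T': "T \<in> measurable (completion M) ?D"
    using measurable_completion[OF T] by simp
  have D: "distr (completion M) ?D T = ?D"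
    using distr_completion[OF T] distr_cong[of "completion M" "completion M" ?D N T T] by simp
  show "T \<in> measurable (completion M) (completion ?D)"
    using D by (intro completion.measurable_completion2[OF T']) simp
  show "completion ?D = distr (completion M) (completion ?D) T"
    using completion.completion_distr_eq[OF T'] D by simp
qed

lemma integrable_completion_distr:
  fixes g :: "'b \<Rightarrow> real"
  assumes T: "T \<in> measurable M N" and g: "integrable (completion (distr M N T)) g"
  shows "integrable (completion M) (\<lambda>x. g (T x))"
    and "integral\<^sup>L (completion M) (\<lambda>x. g (T x)) = integral\<^sup>L (completion (distr M N T)) g"
proof -
  note c = completion_distr[OF T]
  show "integrable (completion M) (\<lambda>x. g (T x))"
    by (rule integrable_distr[OF c(1)]) (use g in \<open>simp flip: c(2)\<close>)
  have "g \<in> borel_measurable (completion (distr M N T))" using g by auto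
  from integral_distr[OF c(1) this]
  show "integral\<^sup>L (completion M) (\<lambda>x. g (T x)) = integral\<^sup>L (completion (distr M N T)) g"
    by (simp flip: c(2))
qed

lemma completion_scale_measure:
  assumes "0 < r"
  shows "completion (scale_measure r M) = scale_measure r (completion M)"
proof -
  have n: "null_sets (scale_measure r M) = null_sets M"
    using assms by (auto simp: null_sets_def)
  have s: "sets (completion (scale_measure r M)) = sets (completion M)"
    by (simp add: sets_completion n space_scale_measure)
  have m: "main_part (scale_measure r M) A = main_part M A" for A
    by (simp add: main_part_def split_completion_def[abs_def] n)
  show ?thesis
    by (rule measure_eqI) (simp_all add: s m)
qed

lemma integrable_scale_measureD:
  fixes g :: "'b \<Rightarrow> real"
  assumes "0 < r" "integrable (scale_measure r M) g"
  shows "integrable M g"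
proof -
  have m: "g \<in> borel_measurable M"
    using assms(2) measurable_cong_sets[of "scale_measure r M" M borel borel] by auto
  have "(\<integral>\<^sup>+x. ennreal (norm (g x)) \<partial>scale_measure r M) = r * (\<integral>\<^sup>+x. ennreal (norm (g x)) \<partial>M)"
    by (rule nn_integral_scale_measure) (use m in measurable)
  then have "r * (\<integral>\<^sup>+x. ennreal (norm (g x)) \<partial>M) < \<infinity>" using assms(2) by (simp add: integrable_iff_bounded)
  then show ?thesis
    using m assms(1) by (auto simp: integrable_iff_bounded ennreal_mult_less_top less_top)
qed

text \<open>
  Coordinates with respect to the standard basis, in any order, preserve Lebesgue measure.
\<close>

lemma distr_basis_coordinates:
  fixes \<beta> :: "'m::finite \<Rightarrow> 'a::euclidean_space"
  assumes \<beta>: "bij_betw \<beta> UNIV Basis"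
  shows "distr lborel borel (\<lambda>x::real^'m. \<Sum>i\<in>UNIV. (x $ i) *\<^sub>R \<beta> i) = lborel"
proof (rule lborel_eqI[symmetric])
  let ?Q = "\<lambda>x::real^'m. \<Sum>i\<in>UNIV. (x $ i) *\<^sub>R \<beta> i"
  have inj: "inj \<beta>" and rng: "range \<beta> = Basis" using \<beta> by (auto simp: bij_betw_def)
  have onb: "\<beta> i \<bullet> \<beta> j = (if i = j then 1 else 0)" for i j
    using inj rng by (metis inj_eq inner_Basis rangeI)
  have Qb: "?Q x \<bullet> \<beta> i = x $ i" for x i
    by (simp add: inner_sum_left onb if_distrib cong: if_cong)
  have m: "?Q \<in> borel_measurable borel" by (intro borel_measurable_continuous_onI continuous_intros)
  fix l u :: 'a assume le: "\<And>b. b \<in> Basis \<Longrightarrow> l \<bullet> b \<le> u \<bullet> b"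
  let ?l = "\<chi> i. l \<bullet> \<beta> i" and ?u = "\<chi> i. u \<bullet> \<beta> i"
  have "?Q -` box l u = box ?l ?u"
    by (auto simp: box_def simp flip: rng simp: Qb Basis_vec_def inner_axis)
  then have "emeasure (distr lborel borel ?Q) (box l u) = emeasure lborel (box ?l ?u)"
    using m by (simp add: emeasure_distr)
  also have "\<dots> = (\<Prod>b\<in>Basis. (?u - ?l) \<bullet> b)"
    by (rule emeasure_lborel_box) (use le rng rangeI[of \<beta>] in \<open>auto simp: Basis_vec_def inner_axis\<close>)
  also have "(\<Prod>b\<in>Basis. (?u - ?l) \<bullet> b) = (\<Prod>b\<in>range (\<lambda>i::'m. axis i (1::real)). (?u - ?l) \<bullet> b)"
    by (rule prod.cong) (auto simp: Basis_vec_def)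
  also have "\<dots> = (\<Prod>i\<in>UNIV. (u - l) \<bullet> \<beta> i)"
    by (subst prod.reindex) (auto simp: inj_on_def axis_eq_axis inner_axis inner_diff_left)
  also have "\<dots> = (\<Prod>b\<in>Basis. (u - l) \<bullet> b)"
    by (rule prod.reindex_bij_betw[OF \<beta>])
  finally show "emeasure (distr lborel borel ?Q) (box l u) = ennreal (\<Prod>b\<in>Basis. (u - l) \<bullet> b)" .
qed simp

text \<open>
  The inequality in the change of variables formula for maps that may take values repeatedly, transported
  from \<open>real^'m\<close> to a Euclidean space by coordinates. The Jacobian may be bounded by a function \<open>g\<close> that is Lebesgue
  measurable only, as happens for functions that are measurable for a completed measure.
\<close>

lemma emeasure_differentiable_image_le:
  fixes f :: "'a::euclidean_space \<Rightarrow> 'a" and \<beta> :: "'m::{finite,wellorder} \<Rightarrow> 'a"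
  assumes \<beta>: "bij_betw \<beta> UNIV Basis"
    and S: "S \<in> sets borel"
    and der: "\<And>x. x \<in> S \<Longrightarrow> (f has_derivative f' x) (at x within S)"
    and bound: "\<And>x. x \<in> S \<Longrightarrow> \<bar>det (\<chi> i j. \<beta> i \<bullet> f' x (\<beta> j))\<bar> \<le> g x"
    and g: "set_integrable lebesgue S g"
    and E: "E \<in> sets borel" "E \<subseteq> f ` S"
  shows "emeasure lborel E \<le> ennreal (LINT x:S|lebesgue. g x)"
proof -
  define Q where "Q = (\<lambda>x::real^'m::{finite,wellorder}. \<Sum>i\<in>UNIV. (x $ i) *\<^sub>R \<beta> i)"
  define R :: "'a \<Rightarrow> real^'m::{finite,wellorder}" where "R = (\<lambda>y. \<chi> i. y \<bullet> \<beta> i)"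
  have inj: "inj \<beta>" and rng: "range \<beta> = Basis" using \<beta> by (auto simp: bij_betw_def)
  have onb: "\<beta> i \<bullet> \<beta> j = (if i = j then 1 else 0)" for i j
    using inj rng by (metis inj_eq inner_Basis rangeI)
  have RQ: "R (Q x) = x" for x
    by (simp add: R_def Q_def vec_eq_iff inner_sum_left onb if_distrib cong: if_cong)
  have QR: "Q (R y) = y" for y
    unfolding R_def Q_def using sum.reindex_bij_betw[OF \<beta>, of "\<lambda>b. (y \<bullet> b) *\<^sub>R b"]
    by (simp add: euclidean_representation)
  have lQ: "linear Q" unfolding Q_def by (rule linearI) (simp_all add: algebra_simps sum.distrib scaleR_sum_right)
  have lR: "linear R" unfolding R_def by (rule linearI) (simp_all add: vec_eq_iff inner_add_left)
  have blQ: "bounded_linear Q" and blR: "bounded_linear R"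
    using lQ lR linear_conv_bounded_linear by blast+
  have mQ: "Q \<in> borel_measurable borel" "R \<in> borel_measurable borel"
    by (intro borel_measurable_continuous_onI linear_continuous_on blQ blR)+
  have dQ: "distr lborel borel Q = lborel" unfolding Q_def by (rule distr_basis_coordinates[OF \<beta>])
  define S' where "S' = Q -` S"
  define F where "F = (\<lambda>x. R (f (Q x)))"
  define F' where "F' = (\<lambda>x h. R (f' (Q x) (Q h)))"
  have S': "S' \<in> sets borel" using measurable_sets_borel[OF mQ(1) S] by (simp add: S'_def)
  have S'l: "S' \<in> sets lebesgue" using S' by simp
  have QS: "Q ` S' = S" unfolding S'_def using QR by (metis surj_def surj_image_vimage_eq)
  have derF: "(F has_derivative F' x) (at x within S')" if "x \<in> S'" for x
  proof -
    have "(f has_derivative f' (Q x)) (at (Q x) within Q ` S')"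
      unfolding QS using that by (intro der) (simp add: S'_def)
    then have "((\<lambda>x. f (Q x)) has_derivative (\<lambda>h. f' (Q x) (Q h))) (at x within S')"
      using blQ by (intro has_derivative_in_compose[where f = Q and g = f]) (auto intro: bounded_linear_imp_has_derivative)
    from bounded_linear.has_derivative[OF blR this] show ?thesis by (simp add: F_def F'_def)
  qed
  have mat: "matrix (F' x) = (\<chi> i j. \<beta> i \<bullet> f' (Q x) (\<beta> j))" for x
  proof -
    have "Q (axis j 1) = \<beta> j" for j
      by (simp add: Q_def axis_def if_distrib[of "\<lambda>r. r *\<^sub>R _"] cong: if_cong)
    then show ?thesis by (simp add: matrix_def F'_def R_def inner_commute)
  qed
  have gi: "integrable lebesgue (\<lambda>x. indicator S x *\<^sub>R g x)" using g by (simp add: set_integrable_def)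
  have T: "Q \<in> measurable lborel borel" using mQ by simp
  have gi': "integrable lebesgue (\<lambda>x. indicator S (Q x) *\<^sub>R g (Q x))"
    "integral\<^sup>L lebesgue (\<lambda>x. indicator S (Q x) *\<^sub>R g (Q x)) = integral\<^sup>L lebesgue (\<lambda>x. indicator S x *\<^sub>R g x)"
    using integrable_completion_distr[OF T, of "\<lambda>x. indicator S x *\<^sub>R g x"] gi unfolding dQ by auto
  have ind: "indicator S (Q x) = (indicator S' x :: real)" for x by (simp add: S'_def indicator_def)
  have sg: "set_integrable lebesgue S' (\<lambda>x. g (Q x))"
    using gi'(1) by (simp add: set_integrable_def ind)
  have ai: "(\<lambda>x. g (Q x)) absolutely_integrable_on S'" using sg by simp
  have dm: "(\<lambda>x. \<bar>det (matrix (F' x))\<bar>) \<in> borel_measurable (lebesgue_on S')"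
    by (intro borel_measurable_abs borel_measurable_det_Jacobian[OF S'l derF])
  have b: "\<bar>det (matrix (F' x))\<bar> \<le> g (Q x)" if "x \<in> S'" for x
    unfolding mat using that by (intro bound) (simp add: S'_def)
  have int: "(\<lambda>x. \<bar>det (matrix (F' x))\<bar>) integrable_on S'"
    by (rule measurable_bounded_by_integrable_imp_integrable[OF dm _ _ S'l, of "\<lambda>x. g (Q x)"])
       (use ai b in \<open>auto simp: absolutely_integrable_on_def\<close>)
  have lm: "F ` S' \<in> lmeasurable" by (rule measurable_differentiable_image[OF S'l derF int])
  have "measure lebesgue (F ` S') \<le> integral S' (\<lambda>x. \<bar>det (matrix (F' x))\<bar>)"
    by (rule measure_differentiable_image[OF S'l derF int])
  also have "\<dots> \<le> integral S' (\<lambda>x. g (Q x))"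
    using int ai b by (intro integral_le) (auto simp: absolutely_integrable_on_def)
  also have "\<dots> = (LINT x:S'|lebesgue. g (Q x))"
    by (rule set_lebesgue_integral_eq_integral(2)[OF sg, symmetric])
  also have "\<dots> = (LINT x:S|lebesgue. g x)"
    using gi'(2) by (simp add: set_lebesgue_integral_def ind)
  finally have le: "measure lebesgue (F ` S') \<le> (LINT x:S|lebesgue. g x)" .
  have "Q -` E \<subseteq> F ` S'"
  proof
    fix x assume "x \<in> Q -` E"
    then obtain y where y: "y \<in> S" "Q x = f y" using E(2) by auto
    then have "x = F (R y)" "R y \<in> S'" using RQ[of x] by (simp_all add: F_def QR S'_def)
    then show "x \<in> F ` S'" by blast
  qed
  have "emeasure lborel E = emeasure lborel (Q -` E)"
    using E(1) T by (subst dQ[symmetric]) (simp add: emeasure_distr)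
  also have "\<dots> = emeasure lebesgue (Q -` E)"
    using measurable_sets_borel[OF mQ(1) E(1)] by simp
  also have "\<dots> \<le> emeasure lebesgue (F ` S')"
    by (rule emeasure_mono) (use \<open>Q -` E \<subseteq> F ` S'\<close> lm in auto)
  also have "\<dots> = ennreal (measure lebesgue (F ` S'))"
    using lm by (simp add: emeasure_eq_measure2 fmeasurableD2 emeasure_eq_ennreal_measure)
  also have "\<dots> \<le> ennreal (LINT x:S|lebesgue. g x)" using le by (rule ennreal_leI)
  finally show ?thesis .
qed

section \<open>Integration over the sphere\<close>

text \<open>
  The spherical measure is the image under \<open>sgn\<close> of Lebesgue measure on the unit ball, up to the factor
  \<open>DIM('a)\<close>.
\<close>

lemma set_integrable_cone_over_sphere:
  fixes D :: "'a::euclidean_space set" and f :: "'a \<Rightarrow> real"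
  assumes f: "set_integrable (completion sphere_measure) D f"
    and S: "S \<in> sets borel" "S \<subseteq> ball 0 1" "\<And>w. w \<in> S \<Longrightarrow> sgn w \<in> D"
  shows "set_integrable lebesgue S (\<lambda>w. f (sgn w))"
proof -
  define R where "R = restrict_space lborel (ball (0::'a) 1)"
  define h where "h = (\<lambda>w::'a. indicator D (sgn w) *\<^sub>R f (sgn w))"
  have [measurable]: "sgn \<in> borel_measurable (borel :: 'a measure)"
    unfolding sgn_div_norm by measurable
  have m: "sgn \<in> measurable R borel" unfolding R_def by (intro measurable_restrict_space1) simp
  have "integrable (completion (scale_measure (of_nat DIM('a)) (distr R borel sgn))) (\<lambda>x. indicator D x *\<^sub>R f x)"
    using f by (simp add: set_integrable_def sphere_measure_def R_def)
  then have "integrable (scale_measure (of_nat DIM('a)) (completion (distr R borel sgn))) (\<lambda>x. indicator D x *\<^sub>R f x)"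
    by (subst (asm) completion_scale_measure) (auto simp: zero_less_iff_neq_zero)
  then have "integrable (completion (distr R borel sgn)) (\<lambda>x. indicator D x *\<^sub>R f x)"
    by (rule integrable_scale_measureD[rotated]) (simp add: zero_less_iff_neq_zero)
  from integrable_completion_distr(1)[OF m this]
  have h: "integrable (completion R) h" by (simp add: h_def)
  then have "h \<in> borel_measurable (completion R)" by auto
  from completion_ex_borel_measurable_real[OF this] obtain h' where
    h': "h' \<in> borel_measurable R" "AE x in R. h x = h' x" by auto
  have "integrable R h'"
    using h measurable_completion[OF h'(1)] AE_completion[OF h'(2)]
      integrable_cong_AE[of h "completion R" h'] integrable_completion[OF h'(1)] by auto
  then have i': "integrable lborel (\<lambda>x. indicator (ball 0 1) x *\<^sub>R h' x)"
    unfolding R_def by (subst (asm) integrable_restrict_space) auto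
  have ae: "AE x in lebesgue. indicator (ball 0 1) x *\<^sub>R h' x = indicator (ball 0 1) x *\<^sub>R h x"
  proof (rule AE_completion)
    have "AE x in lborel. x \<in> ball 0 1 \<longrightarrow> h x = h' x"
      using h'(2) unfolding R_def by (subst (asm) AE_restrict_space_iff) auto
    then show "AE x in lborel. indicator (ball 0 1) x *\<^sub>R h' x = indicator (ball 0 1) x *\<^sub>R h x"
      by eventually_elim (auto simp: indicator_def)
  qed
  have il: "integrable lebesgue (\<lambda>x. indicator (ball 0 1) x *\<^sub>R h' x)"
    using i' integrable_completion[of "\<lambda>x. indicator (ball 0 1) x *\<^sub>R h' x" lborel] by auto
  then have ml: "(\<lambda>x. indicator (ball 0 1) x *\<^sub>R h x) \<in> borel_measurable lebesgue"
    using borel_measurable_AE[OF _ ae] by auto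
  have "integrable lebesgue (\<lambda>x. indicator (ball 0 1) x *\<^sub>R h x)"
    by (rule integrable_cong_AE_imp[OF il ml ae])
  then have "set_integrable lebesgue (ball 0 1) h" by (simp add: set_integrable_def)
  then have "set_integrable lebesgue S h"
    by (rule set_integrable_subset) (use S in auto)
  then show ?thesis
    by (rule set_integrable_cong[THEN iffD1, rotated -1]) (use S(3) in \<open>auto simp: h_def\<close>)
qed

text \<open>
  A locally closed set is a countable union of compact sets, and so are its continuous images.
\<close>

lemma borel_continuous_image_open_Int_closed:
  fixes f :: "'a::euclidean_space \<Rightarrow> 'b::euclidean_space"
  assumes "open U" "closed C" "continuous_on (U \<inter> C) f"
  shows "f ` (U \<inter> C) \<in> sets borel"
proof -
  obtain K where K: "\<And>n::nat. compact (K n)" "(\<Union>n. K n) = U"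
    using open_Union_compact_subsets[OF assms(1)] by metis
  have "f ` (U \<inter> C) = (\<Union>n. f ` (K n \<inter> C))" using K(2) by auto
  moreover have "f ` (K n \<inter> C) \<in> sets borel" for n
  proof -
    have "compact (f ` (K n \<inter> C))"
      using K assms(2,3) by (intro compact_continuous_image compact_Int_closed continuous_on_subset[OF assms(3)]) auto
    then show ?thesis by (simp add: borel_compact)
  qed
  ultimately show ?thesis by auto
qed

section \<open>Tangent directions and the Gauss map\<close>

text \<open>
  The directions of secants of \<open>M\<close> that shrink to \<open>x\<close>. Derivatives within \<open>M\<close> are determined along them, and
  on a regular level set the intermediate value theorem provides them.
\<close>

definition tangent_direction :: "'a::euclidean_space set \<Rightarrow> 'a \<Rightarrow> 'a \<Rightarrow> bool" where
  "tangent_direction M x w \<longleftrightarrow> (\<exists>m s. (\<forall>n::nat. m n \<in> M \<and> 0 < (s n :: real)) \<and> s \<longlonglongrightarrow> 0 \<and>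
      (\<lambda>n. (m n - x) /\<^sub>R s n) \<longlonglongrightarrow> w)"

lemma has_derivative_sgn:
  fixes v :: "'a::real_inner"
  assumes "v \<noteq> 0"
  shows "(sgn has_derivative (\<lambda>h. (h - (sgn v \<bullet> h) *\<^sub>R sgn v) /\<^sub>R norm v)) (at v)"
proof -
  have "((\<lambda>v::'a. inverse (norm v)) has_derivative (\<lambda>h. - (inverse (norm v) * (h \<bullet> sgn v) * inverse (norm v)))) (at v)"
    using assms by (intro Deriv.has_derivative_inverse has_derivative_norm) auto
  then have "((\<lambda>v. inverse (norm v) *\<^sub>R v) has_derivative
      (\<lambda>h. inverse (norm v) *\<^sub>R h + (- (inverse (norm v) * (h \<bullet> sgn v) * inverse (norm v))) *\<^sub>R v)) (at v)"
    by (intro has_derivative_scaleR has_derivative_ident)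
  moreover have "inverse (norm v) *\<^sub>R h + (- (inverse (norm v) * (h \<bullet> sgn v) * inverse (norm v))) *\<^sub>R v
      = (h - (sgn v \<bullet> h) *\<^sub>R sgn v) /\<^sub>R norm v" for h
    using assms by (simp add: sgn_div_norm algebra_simps inner_commute)
  ultimately show ?thesis unfolding sgn_div_norm[abs_def] by simp
qed

lemma has_derivative_along_line:
  assumes "GDERIV g x :> G"
  shows "((\<lambda>s. g (x + s *\<^sub>R v)) has_real_derivative v \<bullet> G) (at 0)"
proof -
  have "(g has_derivative (\<lambda>h. h \<bullet> G)) (at (x + 0 *\<^sub>R v))" using assms by (simp add: gderiv_def)
  moreover have "((\<lambda>s. x + s *\<^sub>R v) has_derivative (\<lambda>s. s *\<^sub>R v)) (at 0)"
    by (auto intro!: derivative_eq_intros)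
  ultimately have "(g \<circ> (\<lambda>s. x + s *\<^sub>R v) has_derivative (\<lambda>h. h \<bullet> G) \<circ> (\<lambda>s. s *\<^sub>R v)) (at 0)"
    by (intro diff_chain_at) auto
  then show ?thesis by (simp add: has_field_derivative_def o_def mult_commute_abs)
qed

text \<open>
  Moving from \<open>x\<close> by \<open>s (w + v)\<close> or \<open>s (w - v)\<close>, where \<open>w\<close> is tangential and \<open>v\<close> transversal, changes \<open>g\<close> to first
  order by \<open>s (v \<bullet> G)\<close> or its negative; the intermediate value theorem gives a zero between.
\<close>

lemma zero_on_transversal:
  fixes g :: "'a::euclidean_space \<Rightarrow> real"
  assumes U: "open U" "x \<in> U" and c: "continuous_on U g" and x: "g x = 0"
    and G: "GDERIV g x :> G" "w \<bullet> G = 0" "v \<bullet> G > 0"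
  shows "eventually (\<lambda>s. \<exists>\<tau>. \<bar>\<tau>\<bar> \<le> 1 \<and> x + s *\<^sub>R (w + \<tau> *\<^sub>R v) \<in> U \<and> g (x + s *\<^sub>R (w + \<tau> *\<^sub>R v)) = 0) (at_right 0)"
proof -
  have "((\<lambda>s. g (x + s *\<^sub>R (w + v))) has_real_derivative v \<bullet> G) (at 0)"
    using has_derivative_along_line[OF G(1), of "w + v"] G by (simp add: inner_add_left)
  from DERIV_pos_inc_right[OF this G(3)] obtain d1 where
    d1: "d1 > 0" "\<And>s. 0 < s \<Longrightarrow> s < d1 \<Longrightarrow> 0 < g (x + s *\<^sub>R (w + v))" using x by auto
  have "((\<lambda>s. g (x + s *\<^sub>R (w - v))) has_real_derivative - (v \<bullet> G)) (at 0)"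
    using has_derivative_along_line[OF G(1), of "w - v"] G by (simp add: inner_diff_left)
  from DERIV_neg_dec_right[OF this] obtain d2 where
    d2: "d2 > 0" "\<And>s. 0 < s \<Longrightarrow> s < d2 \<Longrightarrow> g (x + s *\<^sub>R (w - v)) < 0" using x G(3) by auto
  obtain r where r: "r > 0" "ball x r \<subseteq> U" using U by (meson open_contains_ball)
  define d3 where "d3 = r / (norm w + norm v + 1)"
  have k: "norm w + norm v + 1 > 0" by (smt (verit) norm_ge_zero)
  have d3: "d3 > 0" using r k by (simp add: d3_def)
  have "\<exists>\<tau>. \<bar>\<tau>\<bar> \<le> 1 \<and> x + s *\<^sub>R (w + \<tau> *\<^sub>R v) \<in> U \<and> g (x + s *\<^sub>R (w + \<tau> *\<^sub>R v)) = 0"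
    if s: "0 < s" "s < min d1 (min d2 d3)" for s
  proof -
    have inU: "x + s *\<^sub>R (w + \<tau> *\<^sub>R v) \<in> U" if "\<bar>\<tau>\<bar> \<le> 1" for \<tau>
    proof -
      have "norm (w + \<tau> *\<^sub>R v) \<le> norm w + norm v"
        using norm_triangle_ineq[of w "\<tau> *\<^sub>R v"] mult_right_mono[OF that norm_ge_zero[of v]] by simp
      then have "s * norm (w + \<tau> *\<^sub>R v) \<le> s * (norm w + norm v + 1)"
        using s by (intro mult_left_mono) auto
      also have "\<dots> < r" using s k by (simp add: d3_def pos_less_divide_eq)
      finally show ?thesis using s by (intro subsetD[OF r(2)]) (auto simp: dist_norm)
    qed
    have "continuous_on {-1..1} (\<lambda>\<tau>. g (x + s *\<^sub>R (w + \<tau> *\<^sub>R v)))"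
      by (rule continuous_on_compose2[OF c]) (use inU in \<open>auto intro!: continuous_intros\<close>)
    then have "\<exists>\<tau>\<ge>-1. \<tau> \<le> 1 \<and> g (x + s *\<^sub>R (w + \<tau> *\<^sub>R v)) = 0"
      using d1(2)[of s] d2(2)[of s] s by (intro IVT') auto
    then obtain \<tau> where "-1 \<le> \<tau>" "\<tau> \<le> 1" "g (x + s *\<^sub>R (w + \<tau> *\<^sub>R v)) = 0" by blast
    then show ?thesis using inU[of \<tau>] by (intro exI[of _ \<tau>]) auto
  qed
  then show ?thesis unfolding eventually_at_right_field using d1 d2 d3
    by (intro exI[of _ "min d1 (min d2 d3)"]) auto
qed

lemma local_defining_functionD:
  assumes "local_defining_function M U g"
  obtains G G' where "open U" "M \<inter> U = {x \<in> U. g x = 0}"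
    "\<And>x. x \<in> U \<Longrightarrow> GDERIV g x :> G x"
    "\<And>x. x \<in> U \<Longrightarrow> (G has_derivative blinfun_apply (G' x)) (at x)"
    "continuous_on U g" "\<And>x. x \<in> M \<inter> U \<Longrightarrow> G x \<noteq> 0"
proof -
  from assms obtain G and G' :: "'a \<Rightarrow> 'a \<Rightarrow>\<^sub>L 'a" where *: "open U" "M \<inter> U = {x \<in> U. g x = 0}"
    "\<And>x. x \<in> U \<Longrightarrow> GDERIV g x :> G x"
    "\<And>x. x \<in> U \<Longrightarrow> (G has_derivative blinfun_apply (G' x)) (at x)"
    "\<And>x. x \<in> M \<inter> U \<Longrightarrow> G x \<noteq> 0"
    unfolding local_defining_function_def by blast
  moreover have "continuous_on U g"
    using *(3) unfolding gderiv_def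
    by (auto intro!: continuous_at_imp_continuous_on has_derivative_continuous)
  ultimately show ?thesis using that by blast
qed

text \<open>
  The transversal vector \<open>v\<close> of the previous lemma is taken as small as desired.
\<close>

lemma tangent_directionI:
  assumes ldf: "local_defining_function M U g" and x: "x \<in> M \<inter> U" and G: "GDERIV g x :> G" and w: "w \<bullet> G = 0"
  shows "tangent_direction M x w"
proof -
  obtain G1 G1' where l: "open U" "M \<inter> U = {x \<in> U. g x = 0}" "GDERIV g x :> G1 x"
    "continuous_on U g" "G1 x \<noteq> 0"
    using local_defining_functionD[OF ldf] x by (metis IntD2)
  have "G1 x = G" using GDERIV_DERIV_compose l(3) G unfolding gderiv_def
    by (metis has_derivative_unique inner_eq_zero_iff inner_commute inner_diff_right right_minus_eq)
  then have "G \<noteq> 0" using l by simp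
  have xU: "x \<in> U" "g x = 0" using x l(2) by auto
  have "\<exists>m s. m \<in> M \<and> 0 < s \<and> s < inverse (real (Suc n)) \<and> norm ((m - x) /\<^sub>R s - w) \<le> inverse (real (Suc n))" for n
  proof -
    define v where "v = inverse (real (Suc n)) *\<^sub>R sgn G"
    have "v \<bullet> G > 0" using \<open>G \<noteq> 0\<close> by (simp add: v_def sgn_div_norm)
    from zero_on_transversal[OF l(1) xU(1) l(4) xU(2) G w this]
    have "eventually (\<lambda>s. (\<exists>\<tau>. \<bar>\<tau>\<bar> \<le> 1 \<and> x + s *\<^sub>R (w + \<tau> *\<^sub>R v) \<in> U \<and> g (x + s *\<^sub>R (w + \<tau> *\<^sub>R v)) = 0)
        \<and> 0 < s \<and> s < inverse (real (Suc n))) (at_right 0)"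
      by (intro eventually_conj) (auto intro!: eventually_at_right_less eventually_at_rightI[of 0 "inverse (real (Suc n))"])
    then obtain s \<tau> where s: "0 < s" "s < inverse (real (Suc n))" "\<bar>\<tau>\<bar> \<le> 1"
      "x + s *\<^sub>R (w + \<tau> *\<^sub>R v) \<in> U" "g (x + s *\<^sub>R (w + \<tau> *\<^sub>R v)) = 0"
      using eventually_happens'[OF trivial_limit_at_right_real] by blast
    then have "x + s *\<^sub>R (w + \<tau> *\<^sub>R v) \<in> M" using l(2) by blast
    moreover have "norm ((x + s *\<^sub>R (w + \<tau> *\<^sub>R v) - x) /\<^sub>R s - w) \<le> inverse (real (Suc n))"
    proof -
      have "norm ((x + s *\<^sub>R (w + \<tau> *\<^sub>R v) - x) /\<^sub>R s - w) = \<bar>\<tau>\<bar> * norm v"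
        using s(1) by (simp add: algebra_simps)
      also have "\<dots> \<le> 1 * norm v" using s(3) by (intro mult_right_mono) auto
      also have "\<dots> = inverse (real (Suc n))" using \<open>G \<noteq> 0\<close> by (simp add: v_def norm_sgn)
      finally show ?thesis .
    qed
    ultimately show ?thesis using s by blast
  qed
  then obtain m s where ms: "\<And>n. m n \<in> M \<and> 0 < s n \<and> s n < inverse (real (Suc n)) \<and>
      norm ((m n - x) /\<^sub>R s n - w) \<le> inverse (real (Suc n))" by metis
  have "s \<longlonglongrightarrow> 0"
    by (rule tendsto_sandwich[OF _ _ tendsto_const LIMSEQ_inverse_real_of_nat])
       (use ms in \<open>auto intro!: always_eventually less_imp_le\<close>)
  moreover have "(\<lambda>n. (m n - x) /\<^sub>R s n) \<longlonglongrightarrow> w"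
    by (rule LIM_zero_cancel, rule Lim_null_comparison[OF _ LIMSEQ_inverse_real_of_nat])
       (use ms in \<open>auto intro!: always_eventually\<close>)
  ultimately show ?thesis unfolding tangent_direction_def using ms by blast
qed

text \<open>
  A derivative within \<open>M\<close> is the limit of difference quotients along the secants that define a tangent
  direction. The secant points may coincide with \<open>x\<close>, so the error quotient \<open>e\<close> is needed at \<open>x\<close> as well;
  there it is \<open>0\<close>.
\<close>

lemma derivative_on_tangent_direction:
  fixes F :: "'a::euclidean_space \<Rightarrow> 'b::real_normed_vector"
  assumes "tangent_direction M x w" "x \<in> M" and F: "(F has_derivative A) (at x within M)"
  obtains m s where "\<And>n::nat. m n \<in> M \<and> 0 < (s n :: real)" "m \<longlonglongrightarrow> x" "(\<lambda>n. (m n - x) /\<^sub>R s n) \<longlonglongrightarrow> w"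
    "(\<lambda>n. (F (m n) - F x) /\<^sub>R s n) \<longlonglongrightarrow> A w"
proof -
  from assms obtain m s where ms: "\<And>n. m n \<in> M \<and> 0 < s n" "s \<longlonglongrightarrow> 0" "(\<lambda>n. (m n - x) /\<^sub>R s n) \<longlonglongrightarrow> w"
    unfolding tangent_direction_def by blast
  have s0: "s n \<noteq> 0" for n using ms(1)[of n] by auto
  have "(\<lambda>n. s n *\<^sub>R ((m n - x) /\<^sub>R s n)) \<longlonglongrightarrow> 0 *\<^sub>R w" by (intro tendsto_scaleR ms)
  then have mx: "m \<longlonglongrightarrow> x" using s0 by (simp add: LIM_zero_iff)
  define e where "e y = (F y - F x - A (y - x)) /\<^sub>R norm (y - x)" for y
  have bl: "bounded_linear A" using F by (rule has_derivative_bounded_linear)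
  have "(e \<longlongrightarrow> 0) (at x within M)"
    using F by (simp add: has_derivative_within e_def[abs_def] divide_inverse diff_diff_eq)
  moreover have "e x = 0" by (simp add: e_def)
  ultimately have "(e \<longlongrightarrow> 0) (inf (nhds x) (principal M))"
    unfolding tendsto_def at_within_def eventually_inf_principal
    by (auto elim!: eventually_mono)
  moreover have "filterlim m (inf (nhds x) (principal M)) sequentially"
    using mx ms(1) by (simp add: filterlim_inf filterlim_principal)
  ultimately have "(\<lambda>n. e (m n)) \<longlonglongrightarrow> 0" by (rule filterlim_compose)
  then have "(\<lambda>n. A ((m n - x) /\<^sub>R s n) + norm ((m n - x) /\<^sub>R s n) *\<^sub>R e (m n)) \<longlonglongrightarrow> A w + norm w *\<^sub>R 0"
    by (intro tendsto_add tendsto_scaleR tendsto_norm ms bounded_linear.tendsto[OF bl])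
  moreover have "A ((m n - x) /\<^sub>R s n) + norm ((m n - x) /\<^sub>R s n) *\<^sub>R e (m n) = (F (m n) - F x) /\<^sub>R s n" for n
  proof (cases "m n = x")
    case True then show ?thesis using bl by (simp add: linear_0 bounded_linear.linear)
  next
    case False
    have "norm ((m n - x) /\<^sub>R s n) *\<^sub>R e (m n) = (F (m n) - F x - A (m n - x)) /\<^sub>R s n"
      using False ms(1)[of n] by (simp add: e_def)
    moreover have "A ((m n - x) /\<^sub>R s n) = A (m n - x) /\<^sub>R s n"
      by (rule linear_scale[OF bounded_linear.linear[OF bl]])
    ultimately show ?thesis by (simp add: algebra_simps)
  qed
  ultimately have "(\<lambda>n. (F (m n) - F x) /\<^sub>R s n) \<longlonglongrightarrow> A w" by simp
  then show ?thesis using that ms mx by blast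
qed

text \<open>
  Two functions that define \<open>M\<close> near \<open>x\<close> have parallel gradients at \<open>x\<close>: each of them vanishes on \<open>M\<close>, so its
  derivative vanishes in the tangent directions, which the other gradient determines.
\<close>

lemma unit_normal_parallel:
  assumes ldf: "local_defining_function M U g" and x: "x \<in> M \<inter> U" and G: "GDERIV g x :> G"
    and n: "unit_normal M x \<nu>"
  shows "\<nu> = sgn G \<or> \<nu> = - sgn G"
proof -
  from n obtain V f c where n: "norm \<nu> = 1" "x \<in> M \<inter> V" and f: "local_defining_function M V f"
    and c: "GDERIV f x :> c *\<^sub>R \<nu>" unfolding unit_normal_def by blast
  have nonzero: "D \<noteq> 0" if D: "local_defining_function M W k" "x \<in> M \<inter> W" "GDERIV k x :> D" for W k D
  proof -
    obtain K where K: "GDERIV k x :> K x" "K x \<noteq> 0"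
      using local_defining_functionD[OF D(1)] D(2) by (metis IntD2)
    then have "(\<lambda>h. h \<bullet> K x) = (\<lambda>h. h \<bullet> D)"
      using D(3) unfolding gderiv_def by (metis has_derivative_unique)
    then have "(K x - D) \<bullet> K x = (K x - D) \<bullet> D" by metis
    then have "(K x - D) \<bullet> (K x - D) = 0" by (simp add: inner_diff_right)
    then show ?thesis using K by auto
  qed
  have c0: "c \<noteq> 0" using nonzero[OF f n(2) c] by auto
  have G0: "G \<noteq> 0" using nonzero[OF ldf x G] .
  have V: "open V" "M \<inter> V = {y \<in> V. f y = 0}"
    using f unfolding local_defining_function_def by blast+
  have orth: "w \<bullet> \<nu> = 0" if w: "w \<bullet> G = 0" for w
  proof -
    have "(f has_derivative (\<lambda>h. h \<bullet> c *\<^sub>R \<nu>)) (at x within M)"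
      using c unfolding gderiv_def by (rule has_derivative_at_withinI)
    then obtain m s where m: "\<And>n::nat. m n \<in> M \<and> 0 < (s n :: real)" "m \<longlonglongrightarrow> x"
      "(\<lambda>n. (f (m n) - f x) /\<^sub>R s n) \<longlonglongrightarrow> w \<bullet> c *\<^sub>R \<nu>"
      using derivative_on_tangent_direction[OF tangent_directionI[OF ldf x G w], of f] x by blast
    have "eventually (\<lambda>n. m n \<in> V) sequentially"
      using m(2) V(1) n(2) by (auto dest: topological_tendstoD)
    then have "eventually (\<lambda>n. (f (m n) - f x) /\<^sub>R s n = 0) sequentially"
    proof eventually_elim
      case (elim n)
      then have "f (m n) = 0" "f x = 0" using m(1)[of n] V(2) n(2) by blast+
      then show ?case by simp
    qed
    then have "(\<lambda>n. (f (m n) - f x) /\<^sub>R s n) \<longlonglongrightarrow> 0" by (rule tendsto_eventually)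
    then have "w \<bullet> c *\<^sub>R \<nu> = 0" using m(3) LIMSEQ_unique by blast
    then show ?thesis using c0 by simp
  qed
  define k where "k = \<nu> \<bullet> sgn G"
  have s1: "sgn G \<bullet> sgn G = 1" using G0 by (simp add: dot_square_norm norm_sgn)
  have sG: "(\<nu> - k *\<^sub>R sgn G) \<bullet> sgn G = 0" by (simp add: inner_diff_left s1) (simp add: k_def)
  then have "(\<nu> - k *\<^sub>R sgn G) \<bullet> G = 0" using G0 by (simp add: sgn_div_norm)
  then have "(\<nu> - k *\<^sub>R sgn G) \<bullet> \<nu> = 0" by (rule orth)
  then have "(\<nu> - k *\<^sub>R sgn G) \<bullet> (\<nu> - k *\<^sub>R sgn G) = 0" using sG by (simp add: inner_diff_right)
  then have e: "\<nu> = k *\<^sub>R sgn G" by simp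
  then have "norm (k *\<^sub>R sgn G) = 1" using n(1) by simp
  then have "\<bar>k\<bar> = 1" using G0 by (simp add: norm_sgn)
  then show ?thesis using e by (auto simp: abs_if split: if_splits)
qed

text \<open>
  The other points of \<open>M\<close> orient the normal at \<open>x\<close>; if there were none, both unit normals would satisfy
  the description in \<open>gauss_map\<close>.
\<close>

locale strictly_convex_C2_hypersurface =
  fixes M :: "'a::euclidean_space set"
  assumes C2: "C2_hypersurface M" and sc: "strictly_convex_hypersurface M"
    and not_singleton: "M \<noteq> {x}"
begin

abbreviation "N \<equiv> gauss_map M"

lemma ex_other: "x \<in> M \<Longrightarrow> \<exists>z\<in>M. z \<noteq> x"
  using not_singleton[of x] by blast

lemma gauss_map_props:
  assumes x: "x \<in> M"
  shows "unit_normal M x (N x)" "y \<in> M \<Longrightarrow> y \<noteq> x \<Longrightarrow> N x \<bullet> (y - x) < 0"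
proof -
  obtain \<nu> where \<nu>: "unit_normal M x \<nu>" "\<And>y. y \<in> M - {x} \<Longrightarrow> \<nu> \<bullet> (y - x) < 0"
    using sc x unfolding strictly_convex_hypersurface_def by blast
  obtain z where z: "z \<in> M" "z \<noteq> x" using ex_other[OF x] by blast
  obtain U g where U: "x \<in> U" "local_defining_function M U g"
    using C2 x unfolding C2_hypersurface_def by blast
  obtain G where G: "GDERIV g x :> G" using local_defining_functionD[OF U(2)] U(1) by metis
  have "N x = \<nu>"
    unfolding gauss_map_def
  proof (rule the_equality)
    show "unit_normal M x \<nu> \<and> (\<forall>y\<in>M. \<nu> \<bullet> (y - x) \<le> 0)"
      using \<nu> by (metis Diff_iff diff_self inner_zero_right less_imp_le order_refl singletonD)
    fix \<nu>' assume \<nu>': "unit_normal M x \<nu>' \<and> (\<forall>y\<in>M. \<nu>' \<bullet> (y - x) \<le> 0)"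
    have "\<nu>' = \<nu> \<or> \<nu>' = - \<nu>"
      using unit_normal_parallel[OF U(2) _ G] U(1) x \<nu>(1) \<nu>' by (metis IntI minus_minus)
    moreover have "\<nu>' \<noteq> - \<nu>" using \<nu>' \<nu>(2)[of z] z by force
    ultimately show "\<nu>' = \<nu>" by blast
  qed
  with \<nu> show "unit_normal M x (N x)" "y \<in> M \<Longrightarrow> y \<noteq> x \<Longrightarrow> N x \<bullet> (y - x) < 0" by auto
qed

lemma norm_gauss_map: "x \<in> M \<Longrightarrow> norm (N x) = 1"
  using gauss_map_props(1) by (auto simp: unit_normal_def)

lemma inj_gauss_map: "inj_on N M"
proof (rule inj_onI, rule ccontr)
  fix x y assume *: "x \<in> M" "y \<in> M" "N x = N y" "x \<noteq> y"
  then have "N x \<bullet> (y - x) < 0" "N x \<bullet> (x - y) < 0" using gauss_map_props(2) by metis+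
  then show False by (simp add: inner_diff_right)
qed

lemma inverse_gauss_map: "x \<in> M \<Longrightarrow> inverse_gauss_map M (N x) = x"
  unfolding inverse_gauss_map_def by (rule the_inv_into_f_f[OF inj_gauss_map])

text \<open>
  Near \<open>x\<close> the Gauss map is the normalised gradient of one defining function, up to a sign that is
  constant: if \<open>z\<close> is another point of \<open>M\<close>, the sign is determined by \<open>N y \<bullet> (z - y) < 0\<close>, and this
  condition is open in \<open>y\<close>.
\<close>

lemma local_frame:
  assumes x: "x \<in> M"
  obtains U g G \<sigma> V where "local_defining_function M U g" "open V" "x \<in> V" "V \<subseteq> U" "\<sigma> = 1 \<or> \<sigma> = (-1::real)"
    "\<And>y. y \<in> U \<Longrightarrow> GDERIV g y :> G y" "\<And>y. y \<in> U \<Longrightarrow> G differentiable at y" "\<And>y. y \<in> M \<inter> U \<Longrightarrow> G y \<noteq> 0"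
    "\<And>y. y \<in> M \<inter> V \<Longrightarrow> N y = \<sigma> *\<^sub>R sgn (G y)"
proof -
  obtain U g where U: "x \<in> U" "local_defining_function M U g"
    using C2 x unfolding C2_hypersurface_def by blast
  from local_defining_functionD[OF U(2)] obtain G G' where G: "open U"
    "\<And>y. y \<in> U \<Longrightarrow> GDERIV g y :> G y"
    "\<And>y. y \<in> U \<Longrightarrow> (G has_derivative blinfun_apply (G' y)) (at y)"
    "\<And>y. y \<in> M \<inter> U \<Longrightarrow> G y \<noteq> 0" by metis
  have par: "N y = sgn (G y) \<or> N y = - sgn (G y)" if "y \<in> M \<inter> U" for y
    using unit_normal_parallel[OF U(2) that G(2)] gauss_map_props(1) that by blast
  obtain \<sigma> :: real where \<sigma>: "\<sigma> = 1 \<or> \<sigma> = -1" "N x = \<sigma> *\<^sub>R sgn (G x)"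
    using par[of x] x U(1) by (metis IntI scaleR_minus1_left scaleR_one)
  obtain z where z: "z \<in> M" "z \<noteq> x" using ex_other[OF x] by blast
  have cG: "isCont G x" using has_derivative_continuous[OF G(3)[OF U(1)]] .
  have "G x \<noteq> 0" using G(4) x U(1) by blast
  with cG have "isCont (\<lambda>y. (\<sigma> *\<^sub>R sgn (G y)) \<bullet> (z - y)) x"
    unfolding isCont_def by (intro tendsto_intros) auto
  then have "((\<lambda>y. (\<sigma> *\<^sub>R sgn (G y)) \<bullet> (z - y)) \<longlongrightarrow> (\<sigma> *\<^sub>R sgn (G x)) \<bullet> (z - x)) (nhds x)"
    unfolding isCont_def by (rule tendsto_at_iff_tendsto_nhds[THEN iffD1])
  moreover have "(\<sigma> *\<^sub>R sgn (G x)) \<bullet> (z - x) < 0" using gauss_map_props(2)[OF x z] \<sigma>(2) by simp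
  ultimately have "eventually (\<lambda>y. (\<sigma> *\<^sub>R sgn (G y)) \<bullet> (z - y) < 0) (nhds x)" by (rule order_tendstoD)
  moreover have "eventually (\<lambda>y. y \<in> U - {z}) (nhds x)"
    using G(1) U(1) z(2) by (intro eventually_nhds_in_open) auto
  ultimately have "eventually (\<lambda>y. y \<in> U - {z} \<and> (\<sigma> *\<^sub>R sgn (G y)) \<bullet> (z - y) < 0) (nhds x)"
    by eventually_elim simp
  then obtain V where V: "open V" "x \<in> V"
    "\<And>y. y \<in> V \<Longrightarrow> y \<in> U - {z} \<and> (\<sigma> *\<^sub>R sgn (G y)) \<bullet> (z - y) < 0"
    unfolding eventually_nhds by blast
  have "N y = \<sigma> *\<^sub>R sgn (G y)" if y: "y \<in> M \<inter> V" for y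
  proof -
    have "N y \<bullet> (z - y) < 0" using gauss_map_props(2)[of y z] y z V(3) by blast
    then show ?thesis using par[of y] V(3)[of y] y \<sigma>(1) by auto
  qed
  then show ?thesis
    using that[OF U(2) V(1,2) _ \<sigma>(1) G(2)] V(3) G(3,4) unfolding differentiable_def by blast
qed

lemma gauss_map_differentiable:
  assumes x: "x \<in> M"
  obtains A where "(N has_derivative A) (at x within M)"
proof -
  obtain U g G \<sigma> V where l: "local_defining_function M U g" "open V" "x \<in> V" "V \<subseteq> U"
    "\<And>y. y \<in> U \<Longrightarrow> G differentiable at y" "\<And>y. y \<in> M \<inter> U \<Longrightarrow> G y \<noteq> 0"
    "\<And>y. y \<in> M \<inter> V \<Longrightarrow> N y = \<sigma> *\<^sub>R sgn (G y)"
    using local_frame[OF x] by metis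
  have "G x \<noteq> 0" "G differentiable at x" using l x by blast+
  then obtain B where "(G has_derivative B) (at x)" unfolding differentiable_def by blast
  then have "((\<lambda>y. sgn (G y)) has_derivative (\<lambda>h. (B h - (sgn (G x) \<bullet> B h) *\<^sub>R sgn (G x)) /\<^sub>R norm (G x))) (at x)"
    by (rule has_derivative_compose[where f = G and g = sgn, OF _ has_derivative_sgn[OF \<open>G x \<noteq> 0\<close>]])
  then obtain A where "((\<lambda>y. \<sigma> *\<^sub>R sgn (G y)) has_derivative A) (at x)"
    using has_derivative_scaleR_right by blast
  then have "((\<lambda>y. \<sigma> *\<^sub>R sgn (G y)) has_derivative A) (at x within M)" by (rule has_derivative_at_withinI)
  then have "(N has_derivative A) (at x within M)"
    by (rule has_derivative_transform_eventually)
       (use l x in \<open>auto simp: eventually_at_topological intro!: exI[of _ V]\<close>)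
  then show ?thesis by (rule that)
qed

lemma continuous_gauss_map: "continuous_on M N"
  unfolding continuous_on_eq_continuous_within
proof
  fix x assume "x \<in> M"
  then obtain A where "(N has_derivative A) (at x within M)" by (rule gauss_map_differentiable)
  then show "continuous (at x within M) N" by (rule has_derivative_continuous)
qed

lemma tangent_direction_gauss_map:
  assumes x: "x \<in> M" and w: "w \<bullet> N x = 0"
  shows "tangent_direction M x w"
proof -
  obtain U g G \<sigma> V where l: "local_defining_function M U g" "x \<in> V" "V \<subseteq> U" "\<sigma> = 1 \<or> \<sigma> = (-1::real)"
    "\<And>y. y \<in> U \<Longrightarrow> GDERIV g y :> G y" "\<And>y. y \<in> M \<inter> U \<Longrightarrow> G y \<noteq> 0"
    "\<And>y. y \<in> M \<inter> V \<Longrightarrow> N y = \<sigma> *\<^sub>R sgn (G y)"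
    using local_frame[OF x] by metis
  have xU: "x \<in> M \<inter> U" using l x by blast
  have "w \<bullet> G x = 0" using w l(4) l(7)[of x] l(2) x l(6)[OF xU] by (auto simp: sgn_div_norm)
  then show ?thesis using tangent_directionI[OF l(1) xU l(5)] xU by blast
qed

text \<open>
  The deviation of \<open>M\<close> from its tangent plane is of second order: a defining function vanishes on \<open>M\<close> and
  its linear part is a multiple of \<open>N x \<bullet> (z - x)\<close>.
\<close>

lemma normal_component_flat:
  assumes x: "x \<in> M"
  shows "((\<lambda>z. N x \<bullet> (z - x)) has_derivative (\<lambda>_. 0)) (at x within M)"
proof -
  obtain U g G \<sigma> V where l: "local_defining_function M U g" "open V" "x \<in> V" "V \<subseteq> U" "\<sigma> = 1 \<or> \<sigma> = (-1::real)"
    "\<And>y. y \<in> U \<Longrightarrow> GDERIV g y :> G y" "\<And>y. y \<in> M \<inter> U \<Longrightarrow> G y \<noteq> 0"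
    "\<And>y. y \<in> M \<inter> V \<Longrightarrow> N y = \<sigma> *\<^sub>R sgn (G y)"
    using local_frame[OF x] by metis
  have xU: "x \<in> M \<inter> U" using l x by blast
  have g0: "g y = 0" if "y \<in> M \<inter> V" for y
    using l(1,4) that unfolding local_defining_function_def by blast
  define k where "k = \<sigma> / norm (G x)"
  have Nx: "N x = k *\<^sub>R G x" using l(8)[of x] l(3) x by (simp add: k_def sgn_div_norm divide_inverse)
  have "(g has_derivative (\<lambda>h. h \<bullet> G x)) (at x within M)"
    using l(6)[of x, unfolded gderiv_def] xU by (metis IntD2 has_derivative_at_withinI)
  moreover have "((\<lambda>z. (z - x) \<bullet> G x) has_derivative (\<lambda>h. (h - 0) \<bullet> G x)) (at x within M)"
    by (intro has_derivative_inner_left has_derivative_diff has_derivative_ident has_derivative_const)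
  ultimately have "((\<lambda>z. k * ((z - x) \<bullet> G x - g z)) has_derivative (\<lambda>h. k * ((h - 0) \<bullet> G x - h \<bullet> G x))) (at x within M)"
    by (intro has_derivative_mult_right has_derivative_diff)
  then have "((\<lambda>z. k * ((z - x) \<bullet> G x - g z)) has_derivative (\<lambda>h. 0)) (at x within M)" by simp
  then show ?thesis
    by (rule has_derivative_transform_eventually)
       (use l(2,3) x g0 in \<open>auto simp: eventually_at_topological Nx inner_commute intro!: exI[of _ V]\<close>)
qed

text \<open>
  A derivative within \<open>M\<close> is determined in the tangential directions only.
\<close>

lemma derivative_unique_on_tangent:
  assumes "x \<in> M" "(F has_derivative A) (at x within M)" "(F has_derivative B) (at x within M)" "w \<bullet> N x = 0"
  shows "A w = B w"
proof -
  have "((\<lambda>y. F y - F y) has_derivative (\<lambda>h. A h - B h)) (at x within M)"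
    using assms by (intro has_derivative_diff)
  from derivative_on_tangent_direction[OF tangent_direction_gauss_map[OF assms(1,4)] assms(1) this]
  obtain s :: "nat \<Rightarrow> real" where "(\<lambda>n. (0::'b) /\<^sub>R s n) \<longlonglongrightarrow> A w - B w" by auto
  then show ?thesis by (simp add: LIMSEQ_const_iff)
qed

end

section \<open>Gauss curvature and the inverse Gauss map\<close>

lemma exists_orthonormal_tangent_basis:
  fixes \<xi> :: "(real^'n) \<times> real"
  assumes "\<xi> \<noteq> 0"
  obtains b :: "'n \<Rightarrow> (real^'n) \<times> real" where "orthonormal b" "\<And>i. b i \<bullet> \<xi> = 0"
proof -
  define T where "T = {x. \<xi> \<bullet> x = 0}"
  have "subspace T" unfolding T_def by (rule subspace_hyperplane)
  from orthonormal_basis_subspace[OF this] obtain B where B: "B \<subseteq> T" "pairwise orthogonal B"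
    "\<And>x. x \<in> B \<Longrightarrow> norm x = 1" "independent B" "card B = dim T" "span B = T" by metis
  have "card B = CARD('n)"
    using B(5) dim_hyperplane[OF assms] by (simp add: T_def)
  moreover have "finite B" using B(4) by (rule independent_imp_finite)
  ultimately obtain b :: "'n \<Rightarrow> _" where b: "bij_betw b UNIV B"
    by (metis finite finite_same_card_bij)
  have bB: "b i \<in> B" for i using b by (auto simp: bij_betw_def)
  have "b i \<bullet> b j = (if i = j then 1 else 0)" for i j
  proof (cases "i = j")
    case True then show ?thesis using B(3)[OF bB[of j]] by (simp add: dot_square_norm)
  next
    case False
    then have "b i \<noteq> b j" using b by (auto simp: bij_betw_def inj_eq)
    then show ?thesis using B(2) bB False unfolding pairwise_def orthogonal_def by auto
  qed
  then have "orthonormal b" by (simp add: orthonormal_def)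
  moreover have "b i \<bullet> \<xi> = 0" for i using bB[of i] B(1) by (auto simp: T_def inner_commute)
  ultimately show ?thesis by (rule that)
qed

lemma orthonormal_tangent_spans:
  fixes \<xi> :: "(real^'n) \<times> real" and b :: "'n \<Rightarrow> (real^'n) \<times> real"
  assumes "\<xi> \<noteq> 0" and b: "orthonormal b" "\<And>i. b i \<bullet> \<xi> = 0" and w: "w \<bullet> \<xi> = 0"
  shows "w \<in> span (range b)"
proof -
  define T where "T = {x. \<xi> \<bullet> x = 0}"
  have nz: "b i \<noteq> 0" for i using b(1) by (metis inner_zero_left orthonormal_def zero_neq_one)
  have inj: "inj b"
    using b(1) by (intro injI) (metis orthonormal_def zero_neq_one)
  have "pairwise orthogonal (range b)"
    using b(1) by (auto simp: pairwise_def orthogonal_def orthonormal_def)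
  then have "independent (range b)"
    using nz by (intro pairwise_orthogonal_independent) auto
  moreover have "card (range b) = CARD('n)" using inj by (rule card_image)
  moreover have "dim T = CARD('n)"
    using dim_hyperplane[OF assms(1)] by (simp add: T_def)
  moreover have "range b \<subseteq> T" using b(2) by (auto simp: T_def inner_commute)
  ultimately have "T \<subseteq> span (range b)" by (intro card_ge_dim_independent) auto
  then show ?thesis using w by (auto simp: T_def inner_commute)
qed

text \<open>
  The definite description in \<open>gauss_curvature\<close> denotes something: neither the choice of the derivative
  nor that of the orthonormal basis changes the determinant.
\<close>

lemma gauss_curvature_eq:
  fixes M :: "((real^'n) \<times> real) set" and b :: "'n \<Rightarrow> (real^'n) \<times> real"
  assumes M: "strictly_convex_C2_hypersurface M" and x: "x \<in> M"
    and A: "(gauss_map M has_derivative A) (at x within M)"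
    and b: "orthonormal b" "\<And>i. b i \<bullet> gauss_map M x = 0"
  shows "gauss_curvature M x = det (\<chi> i j. b i \<bullet> A (b j))"
proof -
  interpret strictly_convex_C2_hypersurface M by fact
  have N0: "N x \<noteq> 0" using norm_gauss_map[OF x] by auto
  show ?thesis
    unfolding gauss_curvature_def
  proof (rule the_equality)
    show "\<exists>A' (b' :: 'n \<Rightarrow> (real^'n) \<times> real). (N has_derivative A') (at x within M) \<and>
        (\<forall>i j. b' i \<bullet> b' j = (if i = j then 1 else 0)) \<and> (\<forall>i. b' i \<bullet> N x = 0) \<and>
        det (\<chi> i j. b i \<bullet> A (b j)) = det (\<chi> i j. b' i \<bullet> A' (b' j))"
      using A b unfolding orthonormal_def by blast
    fix k assume "\<exists>A' (b' :: 'n \<Rightarrow> (real^'n) \<times> real). (N has_derivative A') (at x within M) \<and>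
        (\<forall>i j. b' i \<bullet> b' j = (if i = j then 1 else 0)) \<and> (\<forall>i. b' i \<bullet> N x = 0) \<and>
        k = det (\<chi> i j. b' i \<bullet> A' (b' j))"
    then obtain A' and b' :: "'n \<Rightarrow> (real^'n) \<times> real" where A': "(N has_derivative A') (at x within M)"
      "orthonormal b'" "\<And>i. b' i \<bullet> N x = 0" "k = det (\<chi> i j. b' i \<bullet> A' (b' j))"
      unfolding orthonormal_def by blast
    have "A' (b' j) = A (b' j)" for j
      by (rule derivative_unique_on_tangent[OF x A'(1) A A'(3)])
    then have "k = det (\<chi> i j. b' i \<bullet> A (b' j))" using A'(4) by simp
    also have "\<dots> = det (\<chi> i j. b i \<bullet> A (b j))"
      using orthonormal_tangent_spans[OF N0 b A'(3)] has_derivative_linear[OF A]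
      by (intro det_orthonormal_change b(1) A'(2))
    finally show "k = det (\<chi> i j. b i \<bullet> A (b j))" .
  qed
qed

text \<open>
  The inverse function rule for a map \<open>f\<close> that is differentiable within a set of lower dimension, where
  \<open>f'\<close> has no inverse in the ambient space. The assumption \<open>I\<close> replaces the identity \<open>g' \<circ> f' = id\<close>: it
  holds as soon as \<open>g' \<circ> f'\<close> is the identity in the directions tangent to the set.
\<close>

lemma has_derivative_inverse_within:
  fixes f :: "'a::real_normed_vector \<Rightarrow> 'b::real_normed_vector"
  assumes f: "(f has_derivative f') (at (g y) within g ` S)"
    and I: "((\<lambda>x. x) has_derivative (\<lambda>h. g' (f' h))) (at (g y) within g ` S)"
    and bl: "bounded_linear g'" and cont: "continuous (at y within S) g"
    and fg: "\<And>z. z \<in> S \<Longrightarrow> f (g z) = z" and y: "y \<in> S"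
  shows "(g has_derivative g') (at y within S)"
  unfolding has_derivative_within_alt
proof (intro conjI allI impI bl)
  fix e :: real assume e: "e > 0"
  obtain C where C: "C > 0" "\<And>v. norm (g' v) \<le> norm v * C"
    using bounded_linear.pos_bounded[OF bl] by blast
  \<comment> \<open>\<open>k \<le> 1/4\<close> lets the error term be absorbed, which makes \<open>g\<close> Lipschitz at \<open>y\<close> with constant \<open>2 * C\<close>.\<close>
  define k where "k = min (1/4) (e / (4 * C))"
  have k: "k > 0" "k \<le> 1/4" "4 * k * C \<le> e" using e C by (auto simp: k_def min_def field_simps)
  obtain d1 where d1: "d1 > 0" "\<And>x. x \<in> g ` S \<Longrightarrow> norm (x - g y) < d1 \<Longrightarrow>
      norm (f x - f (g y) - f' (x - g y)) \<le> k / C * norm (x - g y)"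
    using f[unfolded has_derivative_within_alt, THEN conjunct2, rule_format, of "k / C"] k(1) C(1) by auto
  obtain d2 where d2: "d2 > 0" "\<And>x. x \<in> g ` S \<Longrightarrow> norm (x - g y) < d2 \<Longrightarrow>
      norm (x - g y - g' (f' (x - g y))) \<le> k * norm (x - g y)"
    using I[unfolded has_derivative_within_alt, THEN conjunct2, rule_format, of k] k(1) by auto
  obtain d where d: "d > 0" "\<And>z. z \<in> S \<Longrightarrow> dist z y < d \<Longrightarrow> dist (g z) (g y) < min d1 d2"
    using cont[unfolded continuous_within_eps_delta, rule_format, of "min d1 d2"] d1(1) d2(1) by auto
  have "norm (g z - g y - g' (z - y)) \<le> e * norm (z - y)" if z: "z \<in> S" "norm (z - y) < d" for z
  proof -
    define \<Delta> where "\<Delta> = g z - g y"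
    have D: "norm \<Delta> < d1" "norm \<Delta> < d2" using d(2)[of z] z by (auto simp: dist_norm \<Delta>_def)
    have "norm (z - y - f' \<Delta>) \<le> k / C * norm \<Delta>" using d1(2)[of "g z"] D z y fg by (simp add: \<Delta>_def)
    then have "norm (g' (z - y - f' \<Delta>)) \<le> k / C * norm \<Delta> * C"
      using C(1) by (intro order_trans[OF C(2)] mult_right_mono) auto
    also have "k / C * norm \<Delta> * C = k * norm \<Delta>" using C(1) by simp
    finally have 1: "norm (g' (z - y - f' \<Delta>)) \<le> k * norm \<Delta>" .
    have 2: "norm (\<Delta> - g' (f' \<Delta>)) \<le> k * norm \<Delta>" using d2(2)[of "g z"] D z by (simp add: \<Delta>_def)
    have "\<Delta> - g' (z - y) = (\<Delta> - g' (f' \<Delta>)) - g' (z - y - f' \<Delta>)"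
      by (simp add: linear_diff[OF bounded_linear.linear[OF bl]])
    then have "norm (\<Delta> - g' (z - y)) \<le> norm (\<Delta> - g' (f' \<Delta>)) + norm (g' (z - y - f' \<Delta>))"
      using norm_triangle_ineq4[of "\<Delta> - g' (f' \<Delta>)" "g' (z - y - f' \<Delta>)"] by (simp only:)
    then have 3: "norm (\<Delta> - g' (z - y)) \<le> 2 * k * norm \<Delta>" using 1 2 by linarith
    have "norm \<Delta> \<le> norm (\<Delta> - g' (z - y)) + norm (g' (z - y))"
      using norm_triangle_ineq[of "\<Delta> - g' (z - y)" "g' (z - y)"] by simp
    also have "\<dots> \<le> 2 * k * norm \<Delta> + norm (z - y) * C" using 3 C(2)[of "z - y"] by linarith
    also have "2 * k * norm \<Delta> \<le> 1/2 * norm \<Delta>" using k(2) by (intro mult_right_mono) auto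
    finally have "norm \<Delta> \<le> 2 * C * norm (z - y)" by (simp add: algebra_simps)
    then have "2 * k * norm \<Delta> \<le> 2 * k * (2 * C * norm (z - y))" using k(1) by (intro mult_left_mono) auto
    also have "\<dots> = (4 * k * C) * norm (z - y)" by simp
    also have "\<dots> \<le> e * norm (z - y)" using k(3) by (intro mult_right_mono) auto
    finally show ?thesis using 3 unfolding \<Delta>_def by linarith
  qed
  then show "\<exists>d>0. \<forall>z\<in>S. norm (z - y) < d \<longrightarrow> norm (g z - g y - g' (z - y)) \<le> e * norm (z - y)"
    using d(1) by blast
qed

text \<open>
  If the curvature is not zero, the derivative of the Gauss map is invertible on the tangent space. Its
  inverse \<open>B\<close>, extended by \<open>0\<close> in the normal direction, is the derivative of the inverse Gauss map;
  the error made in the normal direction is of higher order by \<open>normal_component_flat\<close>.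
\<close>

lemma inverse_gauss_map_derivative:
  fixes M :: "((real^'n) \<times> real) set" and b :: "'n \<Rightarrow> (real^'n) \<times> real"
  assumes M: "strictly_convex_C2_hypersurface M" and x: "x \<in> M"
    and K: "gauss_curvature M x \<noteq> 0"
    and b: "orthonormal b" "\<And>i. b i \<bullet> gauss_map M x = 0"
    and cont: "continuous_on (gauss_map M ` M) (inverse_gauss_map M)"
  obtains B where "(inverse_gauss_map M has_derivative B) (at (gauss_map M x) within gauss_map M ` M)"
    "\<And>w. gauss_map M x \<bullet> B w = 0" "det (\<chi> i j. b i \<bullet> B (b j)) = 1 / gauss_curvature M x"
proof -
  interpret strictly_convex_C2_hypersurface M by fact
  define \<xi> where "\<xi> = N x"
  have \<xi>: "\<xi> \<noteq> 0" "\<xi> \<bullet> \<xi> = 1" using norm_gauss_map[OF x] by (auto simp: \<xi>_def dot_square_norm)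
  have onb: "b i \<bullet> b j = (if i = j then 1 else 0)" for i j using b(1) by (simp add: orthonormal_def)
  obtain A where A: "(N has_derivative A) (at x within M)" using gauss_map_differentiable[OF x] by blast
  have lA: "linear A" using has_derivative_linear[OF A] .
  define Q :: "real^'n^'n" where "Q = (\<chi> i j. b i \<bullet> A (b j))"
  have detQ: "det Q = gauss_curvature M x"
    unfolding Q_def using gauss_curvature_eq[OF M x A b] by simp
  then obtain R where inv: "R ** Q = mat 1"
    using K by (metis invertible_det_nz invertible_def)
  define B where "B = (\<lambda>\<eta>. \<Sum>i\<in>UNIV. (\<Sum>j\<in>UNIV. R $ i $ j * (b j \<bullet> \<eta>)) *\<^sub>R b i)"
  have "B = (\<lambda>\<eta>. \<Sum>i\<in>UNIV. \<Sum>j\<in>UNIV. (R $ i $ j * (b j \<bullet> \<eta>)) *\<^sub>R b i)"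
    by (simp add: B_def scaleR_sum_left)
  then have lB: "linear B"
    by (intro linearI) (simp_all add: inner_add_right distrib_left scaleR_add_left sum.distrib
        scaleR_sum_right mult.left_commute)
  have Bxi: "\<xi> \<bullet> B w = 0" for w
    using b(2) by (simp add: B_def inner_sum_right inner_commute \<xi>_def)
  have BA: "B (A (b k)) = b k" for k
  proof -
    have "(\<Sum>j\<in>UNIV. R $ i $ j * (b j \<bullet> A (b k))) = (if i = k then 1 else 0)" for i
      using inv by (simp add: Q_def vec_eq_iff matrix_matrix_mult_def mat_def)
    then show ?thesis by (simp add: B_def if_distrib[of "\<lambda>r. r *\<^sub>R _"] cong: if_cong)
  qed
  have lBA: "linear (\<lambda>h. B (A h))" using linear_compose[OF lA lB] by (simp add: o_def)
  have BAw: "B (A w) = w" if "w \<bullet> \<xi> = 0" for w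
  proof -
    have "w \<in> span (range b)"
      by (rule orthonormal_tangent_spans[OF \<xi>(1) b(1) _ that]) (use b(2) in \<open>simp add: \<xi>_def\<close>)
    then show ?thesis
      by (rule linear_eq_on_span[OF lBA linear_ident, rotated]) (use BA in auto)
  qed
  define c where "c = \<xi> - B (A \<xi>)"
  have BAh: "B (A h) = h - (\<xi> \<bullet> h) *\<^sub>R c" for h
  proof -
    have "B (A (h - (\<xi> \<bullet> h) *\<^sub>R \<xi>)) = h - (\<xi> \<bullet> h) *\<^sub>R \<xi>"
      by (rule BAw) (simp add: inner_diff_left \<xi>(2) inner_commute[of h])
    then show ?thesis
      by (simp add: linear_diff[OF lBA] linear_scale[OF lBA] c_def algebra_simps)
  qed
  have XN: "inverse_gauss_map M ` N ` M = M" "inverse_gauss_map M \<xi> = x"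
    using inverse_gauss_map x by (auto simp: image_image \<xi>_def)
  \<comment> \<open>The identity differs from a map with derivative \<open>B \<circ> A\<close> by a multiple of the flat normal component.\<close>
  have "((\<lambda>z. (z - x - (\<xi> \<bullet> (z - x)) *\<^sub>R c) + (\<xi> \<bullet> (z - x)) *\<^sub>R c + x) has_derivative
      (\<lambda>h. (h - 0 - (\<xi> \<bullet> (h - 0)) *\<^sub>R c) + 0 *\<^sub>R c + 0)) (at x within M)"
    using normal_component_flat[OF x]
    by (intro has_derivative_add has_derivative_diff has_derivative_ident has_derivative_const
        has_derivative_scaleR_left has_derivative_inner_right) (simp add: \<xi>_def)
  then have I: "((\<lambda>z. z) has_derivative (\<lambda>h. B (A h))) (at x within M)" by (simp add: BAh)
  have "(inverse_gauss_map M has_derivative B) (at \<xi> within N ` M)"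
  proof (rule has_derivative_inverse_within[where f = N and f' = A])
    show "bounded_linear B" using lB linear_conv_bounded_linear by blast
    show "continuous (at \<xi> within N ` M) (inverse_gauss_map M)"
      using cont x by (auto simp: continuous_on_eq_continuous_within \<xi>_def)
    show "N (inverse_gauss_map M z) = z" if "z \<in> N ` M" for z using that inverse_gauss_map by auto
  qed (use x XN A I in \<open>simp_all add: \<xi>_def del: image_image\<close>)
  moreover have "det (\<chi> i j. b i \<bullet> B (b j)) = 1 / gauss_curvature M x"
  proof -
    have "b i \<bullet> B (b j) = R $ i $ j" for i j
      by (simp add: B_def inner_sum_right onb if_distrib cong: if_cong)
    then have "(\<chi> i j. b i \<bullet> B (b j)) = R" by (simp add: vec_eq_iff)
    moreover have "det R * det Q = 1" using arg_cong[OF inv, of det] by (simp add: det_mul)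
    ultimately show ?thesis using detQ K by (simp add: field_simps)
  qed
  ultimately show ?thesis using Bxi that by (simp add: \<xi>_def)
qed

section \<open>Intrinsic completeness of graphs\<close>

lemma dist_le_intrinsic_dist: "ennreal (dist x y) \<le> intrinsic_dist M x y"
  unfolding intrinsic_dist_def
proof (rule INF_greatest)
  fix \<gamma> assume g: "\<gamma> \<in> {\<gamma>. path \<gamma> \<and> path_image \<gamma> \<subseteq> M \<and> pathstart \<gamma> = x \<and> pathfinish \<gamma> = y}"
  define t :: "nat \<Rightarrow> real" where "t i = (if i = 0 then 0 else 1)" for i
  have "(1, t) \<in> {(N :: nat, t :: nat \<Rightarrow> real). mono t \<and> range t \<subseteq> {0..1}}"
    by (auto simp: t_def mono_def)
  then have "(case (1, t) of (N, t) \<Rightarrow> ennreal (\<Sum>i<N. dist (\<gamma> (t i)) (\<gamma> (t (Suc i))))) \<le> path_length \<gamma>"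
    unfolding path_length_def by (rule SUP_upper)
  then show "ennreal (dist x y) \<le> path_length \<gamma>"
    using g by (simp add: t_def pathstart_def pathfinish_def)
qed

text \<open>
  The bound for two parameters telescopes along a partition.
\<close>

lemma path_length_le:
  assumes "\<And>\<sigma> \<tau>. 0 \<le> \<sigma> \<Longrightarrow> \<sigma> \<le> \<tau> \<Longrightarrow> \<tau> \<le> 1 \<Longrightarrow> dist (\<gamma> \<sigma>) (\<gamma> \<tau>) \<le> \<alpha> \<tau> - \<alpha> \<sigma>"
  shows "path_length \<gamma> \<le> ennreal (\<alpha> 1 - \<alpha> 0)"
  unfolding path_length_def
proof (rule SUP_least, clarify)
  fix N :: nat and t :: "nat \<Rightarrow> real" assume t: "mono t" "range t \<subseteq> {0..1}"
  have r: "0 \<le> t i" "t i \<le> 1" for i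
    using subsetD[OF t(2) rangeI[of t i]] by auto
  have m: "\<alpha> \<sigma> \<le> \<alpha> \<tau>" if "0 \<le> \<sigma>" "\<sigma> \<le> \<tau>" "\<tau> \<le> 1" for \<sigma> \<tau>
    using assms[OF that] zero_le_dist[of "\<gamma> \<sigma>" "\<gamma> \<tau>"] by linarith
  have "(\<Sum>i<N. dist (\<gamma> (t i)) (\<gamma> (t (Suc i)))) \<le> (\<Sum>i<N. \<alpha> (t (Suc i)) - \<alpha> (t i))"
    using r by (intro sum_mono assms monoD[OF t(1)]) auto
  also have "\<dots> = \<alpha> (t N) - \<alpha> (t 0)" by (rule sum_lessThan_telescope)
  also have "\<dots> \<le> \<alpha> 1 - \<alpha> 0" using m[of 0 "t 0"] m[of "t N" 1] r by (auto intro: diff_mono)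
  finally show "ennreal (\<Sum>i<N. dist (\<gamma> (t i)) (\<gamma> (t (Suc i)))) \<le> ennreal (\<alpha> 1 - \<alpha> 0)"
    by (rule ennreal_leI)
qed

text \<open>
  The lift of a segment to the graph of \<open>\<phi>\<close> is no longer than its horizontal and vertical extents together,
  if \<open>\<phi>\<close> is monotone. The sign \<open>\<epsilon>\<close> covers the increasing and the decreasing case.
\<close>

lemma intrinsic_dist_graph_le:
  fixes \<phi> :: "real \<Rightarrow> real" and y d :: "'b::euclidean_space"
  assumes M: "\<And>s. s \<in> closed_segment a b \<Longrightarrow> (y + s *\<^sub>R d, \<phi> s) \<in> M"
    and c: "continuous_on (closed_segment a b) \<phi>"
    and mono: "mono_on (closed_segment a b) (\<lambda>s. \<epsilon> * \<phi> s)" and \<epsilon>: "\<bar>\<epsilon>\<bar> = (1::real)"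
  shows "intrinsic_dist M (y + a *\<^sub>R d, \<phi> a) (y + b *\<^sub>R d, \<phi> b) \<le> ennreal (\<bar>b - a\<bar> * norm d + \<bar>\<phi> b - \<phi> a\<bar>)"
proof -
  define S where "S \<tau> = a + \<tau> * (b - a)" for \<tau>
  define \<gamma> where "\<gamma> \<tau> = (y + S \<tau> *\<^sub>R d, \<phi> (S \<tau>))" for \<tau>
  \<comment> \<open>The parameter \<open>S\<close> runs backwards if \<open>b < a\<close>, and then the monotonicity of \<open>\<phi> \<circ> S\<close> is reversed.\<close>
  define \<delta> where "\<delta> = \<epsilon> * sgn (b - a)"
  define \<alpha> where "\<alpha> \<tau> = \<tau> * (\<bar>b - a\<bar> * norm d) + \<delta> * \<phi> (S \<tau>)" for \<tau>
  have S: "S \<tau> \<in> closed_segment a b" if "0 \<le> \<tau>" "\<tau> \<le> 1" for \<tau>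
    unfolding closed_segment_def S_def using that by (auto intro!: exI[of _ \<tau>] simp: algebra_simps)
  have inc: "\<bar>\<phi> (S \<tau>) - \<phi> (S \<sigma>)\<bar> \<le> \<delta> * \<phi> (S \<tau>) - \<delta> * \<phi> (S \<sigma>)" if "0 \<le> \<sigma>" "\<sigma> \<le> \<tau>" "\<tau> \<le> 1" for \<sigma> \<tau>
  proof -
    consider "a = b" | "a < b" | "b < a" by linarith
    then show ?thesis
    proof cases
      case 1 then show ?thesis by (simp add: S_def)
    next
      case 2
      then have "S \<sigma> \<le> S \<tau>" using that by (simp add: S_def mult_right_mono)
      then have "\<epsilon> * \<phi> (S \<sigma>) \<le> \<epsilon> * \<phi> (S \<tau>)" using mono S that by (auto simp: mono_on_def)
      then show ?thesis using 2 \<epsilon> by (auto simp: \<delta>_def abs_if split: if_splits)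
    next
      case 3
      then have "S \<tau> \<le> S \<sigma>" using that by (simp add: S_def mult_right_mono_neg)
      then have "\<epsilon> * \<phi> (S \<tau>) \<le> \<epsilon> * \<phi> (S \<sigma>)" using mono S that by (auto simp: mono_on_def)
      then show ?thesis using 3 \<epsilon> by (auto simp: \<delta>_def abs_if split: if_splits)
    qed
  qed
  have "dist (\<gamma> \<sigma>) (\<gamma> \<tau>) \<le> \<alpha> \<tau> - \<alpha> \<sigma>" if st: "0 \<le> \<sigma>" "\<sigma> \<le> \<tau>" "\<tau> \<le> 1" for \<sigma> \<tau>
  proof -
    have "\<gamma> \<tau> - \<gamma> \<sigma> = ((S \<tau> - S \<sigma>) *\<^sub>R d, \<phi> (S \<tau>) - \<phi> (S \<sigma>))" by (simp add: \<gamma>_def algebra_simps)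
    then have "dist (\<gamma> \<sigma>) (\<gamma> \<tau>) \<le> norm ((S \<tau> - S \<sigma>) *\<^sub>R d) + norm (\<phi> (S \<tau>) - \<phi> (S \<sigma>))"
      by (metis dist_commute dist_norm norm_Pair_le)
    also have "S \<tau> - S \<sigma> = (\<tau> - \<sigma>) * (b - a)" by (simp add: S_def algebra_simps)
    also have "norm (((\<tau> - \<sigma>) * (b - a)) *\<^sub>R d) = (\<tau> - \<sigma>) * (\<bar>b - a\<bar> * norm d)"
      using st by (simp add: abs_mult)
    finally show ?thesis using inc[OF st] by (simp add: \<alpha>_def algebra_simps)
  qed
  then have "path_length \<gamma> \<le> ennreal (\<alpha> 1 - \<alpha> 0)" by (rule path_length_le)
  also have "\<alpha> 1 - \<alpha> 0 \<le> \<bar>b - a\<bar> * norm d + \<bar>\<phi> b - \<phi> a\<bar>"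
  proof -
    have "\<delta> * (\<phi> b - \<phi> a) \<le> \<bar>\<delta>\<bar> * \<bar>\<phi> b - \<phi> a\<bar>" by (metis abs_ge_self abs_mult)
    also have "\<dots> \<le> 1 * \<bar>\<phi> b - \<phi> a\<bar>"
      using \<epsilon> by (intro mult_right_mono) (auto simp: \<delta>_def abs_mult sgn_if)
    finally show ?thesis by (simp add: \<alpha>_def S_def algebra_simps)
  qed
  finally have L: "path_length \<gamma> \<le> ennreal (\<bar>b - a\<bar> * norm d + \<bar>\<phi> b - \<phi> a\<bar>)" by (simp add: ennreal_leI)
  have "continuous_on {0..1} (\<lambda>\<tau>. \<phi> (S \<tau>))"
    by (rule continuous_on_compose2[OF c]) (use S in \<open>auto simp: S_def intro!: continuous_intros\<close>)
  then have "path \<gamma>" unfolding path_def \<gamma>_def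
    by (intro continuous_intros) (auto simp: S_def intro!: continuous_intros)
  moreover have "path_image \<gamma> \<subseteq> M" using M S by (auto simp: path_image_def \<gamma>_def)
  ultimately have "intrinsic_dist M (y + a *\<^sub>R d, \<phi> a) (y + b *\<^sub>R d, \<phi> b) \<le> path_length \<gamma>"
    unfolding intrinsic_dist_def by (intro INF_lower) (auto simp: pathstart_def pathfinish_def \<gamma>_def S_def)
  then show ?thesis using L by (rule order_trans)
qed

text \<open>
  A convex function on an interval is nondecreasing from the first point on at which it has increased.
\<close>

lemma eventually_monotone_if_subgradients:
  fixes \<phi> :: "real \<Rightarrow> real"
  assumes l: "0 < l" and sub: "\<And>s t. s \<in> {0..<l} \<Longrightarrow> t \<in> {0..<l} \<Longrightarrow> \<phi> s + m s * (t - s) \<le> \<phi> t"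
  obtains a \<epsilon> where "a \<in> {0..<l}" "\<bar>\<epsilon>\<bar> = (1::real)" "mono_on {a..<l} (\<lambda>s. \<epsilon> * \<phi> s)"
proof (cases "\<exists>s\<in>{0..<l}. \<exists>t\<in>{0..<l}. s < t \<and> \<phi> s < \<phi> t")
  case True
  then obtain s t where st: "s \<in> {0..<l}" "t \<in> {0..<l}" "s < t" "\<phi> s < \<phi> t" by blast
  have pos: "m p > 0" if "p \<in> {0..<l}" "s < p" "\<phi> s < \<phi> p" for p
  proof -
    have "0 < m p * (p - s)" using sub[OF that(1) st(1)] that(3) by (simp add: algebra_simps)
    then show ?thesis using that(2) by (simp add: zero_less_mult_iff)
  qed
  have up: "m p > 0" if p: "p \<in> {t..<l}" for p
  proof (rule pos)
    have "m t > 0" using st by (intro pos) auto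
    then have "0 \<le> m t * (p - t)" using p by simp
    then show "\<phi> s < \<phi> p" using sub[OF st(2), of p] p st by auto
  qed (use p st in auto)
  have "mono_on {t..<l} (\<lambda>s. 1 * \<phi> s)"
  proof (rule mono_onI)
    fix p q assume *: "p \<in> {t..<l}" "q \<in> {t..<l}" "p \<le> q"
    then have "0 \<le> m p * (q - p)" using up[of p] by simp
    then show "1 * \<phi> p \<le> 1 * \<phi> q" using sub[of p q] * st by auto
  qed
  then show ?thesis using that[of t 1] st by simp
next
  case noinc: False
  have "mono_on {0..<l} (\<lambda>s. (-1) * \<phi> s)"
  proof (rule mono_onI)
    fix p q assume *: "p \<in> {0..<l}" "q \<in> {0..<l}" "p \<le> q"
    have "\<phi> q \<le> \<phi> p"
    proof (cases "p = q")
      case False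
      then have "p < q" using *(3) by simp
      then show ?thesis using noinc *(1,2) by (meson not_less)
    qed simp
    then show "(-1) * \<phi> p \<le> (-1) * \<phi> q" by simp
  qed
  then show ?thesis by (rule that[of 0 "-1", rotated 2]) (use l in auto)
qed

text \<open>
  A convex function \<open>\<phi>\<close> on \<open>{0..<l}\<close> that is bounded above is bounded and eventually monotone, hence has a
  limit at \<open>l\<close>. The points of the graph along a sequence tending to \<open>l\<close> are then a Cauchy sequence for the
  intrinsic distance, and its limit lies over the endpoint.
\<close>

lemma complete_graph_no_escape:
  fixes M :: "('b::euclidean_space \<times> real) set" and \<phi> :: "real \<Rightarrow> real"
  assumes comp: "complete_hypersurface M" and l: "0 < l"
    and M: "\<And>s. s \<in> {0..<l} \<Longrightarrow> (y + s *\<^sub>R d, \<phi> s) \<in> M"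
    and sub: "\<And>s t. s \<in> {0..<l} \<Longrightarrow> t \<in> {0..<l} \<Longrightarrow> \<phi> s + m s * (t - s) \<le> \<phi> t"
    and cont: "continuous_on {0..<l} \<phi>"
    and C: "\<And>s. s \<in> {0..<l} \<Longrightarrow> \<phi> s \<le> C"
  obtains z where "(y + l *\<^sub>R d, z) \<in> M"
proof -
  obtain a \<epsilon> where a: "a \<in> {0..<l}" "\<bar>\<epsilon>\<bar> = 1" "mono_on {a..<l} (\<lambda>s. \<epsilon> * \<phi> s)"
    using eventually_monotone_if_subgradients[OF l sub] by metis
  define s where "s k = l - (l - a) / real (Suc k)" for k
  have s: "s k \<in> {a..<l}" for k
  proof -
    have "(l - a) / real (Suc k) \<le> (l - a) / 1" using a by (intro divide_left_mono) auto
    moreover have "(l - a) / real (Suc k) > 0" using a by simp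
    ultimately show ?thesis by (simp add: s_def)
  qed
  have s0: "s k \<in> {0..<l}" for k using s[of k] a by auto
  have inc: "incseq s"
    unfolding s_def by (intro incseq_SucI diff_left_mono divide_left_mono) (use a in auto)
  have lim: "s \<longlonglongrightarrow> l"
  proof -
    have "s \<longlonglongrightarrow> l - (l - a) * 0"
      unfolding s_def divide_inverse by (intro tendsto_intros LIMSEQ_inverse_real_of_nat)
    then show ?thesis by simp
  qed
  have "\<bar>\<phi> t\<bar> \<le> \<bar>C\<bar> + \<bar>\<phi> 0\<bar> + \<bar>m 0\<bar> * l" if "t \<in> {0..<l}" for t
  proof -
    have "\<phi> 0 + m 0 * t \<le> \<phi> t" using sub[of 0 t] that l by auto
    moreover have "\<bar>m 0 * t\<bar> \<le> \<bar>m 0\<bar> * l" using that by (auto simp: abs_mult intro!: mult_left_mono)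
    ultimately show ?thesis using C[OF that] by (auto simp: abs_le_iff)
  qed
  then have "Bseq (\<lambda>k. \<epsilon> * \<phi> (s k))"
    using s0 a(2) by (intro BseqI'[of _ "\<bar>C\<bar> + \<bar>\<phi> 0\<bar> + \<bar>m 0\<bar> * l"]) (auto simp: abs_mult)
  moreover have "incseq (\<lambda>k. \<epsilon> * \<phi> (s k))"
    unfolding incseq_def using a(3) s inc by (auto simp: mono_on_def incseq_def)
  ultimately have "Cauchy (\<lambda>k. \<epsilon> * \<phi> (s k))"
    by (intro convergent_Cauchy Bseq_monoseq_convergent) (auto simp: incseq_imp_monoseq)
  define X where "X k = (y + s k *\<^sub>R d, \<phi> (s k))" for k
  have D: "intrinsic_dist M (X i) (X j) \<le> ennreal (\<bar>s j - s i\<bar> * norm d + \<bar>\<phi> (s j) - \<phi> (s i)\<bar>)" for i j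
  proof -
    have sub: "closed_segment (s i) (s j) \<subseteq> {a..<l}" using s by (intro closed_segment_subset) auto
    then have "closed_segment (s i) (s j) \<subseteq> {0..<l}" using a by auto
    then show ?thesis unfolding X_def
      using M a(2) continuous_on_subset[OF cont] mono_on_subset[OF a(3) sub]
      by (intro intrinsic_dist_graph_le[where \<epsilon> = \<epsilon>]) auto
  qed
  have "\<exists>x\<in>M. (\<lambda>i. intrinsic_dist M (X i) x) \<longlonglongrightarrow> 0"
  proof (rule comp[unfolded complete_hypersurface_def, rule_format])
    show "range X \<subseteq> M" using M s0 by (auto simp: X_def)
    fix e :: ennreal assume "e > 0"
    then obtain q where q: "0 < q" "q < e" using dense by blast
    define r where "r = enn2real q"
    have qr: "q = ennreal r" using q by (simp add: r_def top.not_eq_extremum order.strict_trans2 less_top)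
    have r: "r > 0" using q qr by simp
    have "Cauchy s" using lim by (rule LIMSEQ_imp_Cauchy)
    then obtain N1 where N1: "\<And>i j. i \<ge> N1 \<Longrightarrow> j \<ge> N1 \<Longrightarrow> \<bar>s i - s j\<bar> < r / (2 * (norm d + 1))"
      unfolding Cauchy_def dist_real_def using r by (metis add_nonneg_pos divide_pos_pos mult_pos_pos norm_ge_zero zero_less_numeral zero_less_one)
    obtain N2 where N2: "\<And>i j. i \<ge> N2 \<Longrightarrow> j \<ge> N2 \<Longrightarrow> \<bar>\<epsilon> * \<phi> (s i) - \<epsilon> * \<phi> (s j)\<bar> < r / 2"
      using \<open>Cauchy (\<lambda>k. \<epsilon> * \<phi> (s k))\<close> r unfolding Cauchy_def dist_real_def by (metis half_gt_zero)
    have "intrinsic_dist M (X i) (X j) < e" if ij: "i \<ge> max N1 N2" "j \<ge> max N1 N2" for i j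
    proof -
      have "\<bar>s j - s i\<bar> * norm d \<le> \<bar>s j - s i\<bar> * (norm d + 1)" by (intro mult_left_mono) auto
      also have "\<dots> < r / (2 * (norm d + 1)) * (norm d + 1)"
        using N1[of j i] ij by (intro mult_strict_right_mono) (auto intro: add_nonneg_pos)
      also have "\<dots> = r / 2" by (simp add: field_simps add_nonneg_eq_0_iff)
      finally have 1: "\<bar>s j - s i\<bar> * norm d < r / 2" .
      have "\<epsilon> * \<phi> (s j) - \<epsilon> * \<phi> (s i) = \<epsilon> * (\<phi> (s j) - \<phi> (s i))" by (simp add: algebra_simps)
      then have 2: "\<bar>\<phi> (s j) - \<phi> (s i)\<bar> < r / 2" using N2[of j i] ij a(2) by (simp add: abs_mult)
      have "intrinsic_dist M (X i) (X j) \<le> ennreal r"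
        using 1 2 by (intro order_trans[OF D] ennreal_leI) linarith
      then show ?thesis using q qr by simp
    qed
    then show "\<exists>N. \<forall>i\<ge>N. \<forall>j\<ge>N. intrinsic_dist M (X i) (X j) < e" by blast
  qed
  then obtain x where x: "x \<in> M" "(\<lambda>i. intrinsic_dist M (X i) x) \<longlonglongrightarrow> 0" by blast
  have "(\<lambda>i. ennreal (dist (X i) x)) \<longlonglongrightarrow> ennreal 0"
    using tendsto_sandwich[OF _ _ tendsto_const[of 0] x(2), of "\<lambda>i. ennreal (dist (X i) x)"]
    by (simp add: dist_le_intrinsic_dist)
  then have "(\<lambda>i. dist (X i) x) \<longlonglongrightarrow> 0" by (subst (asm) tendsto_ennreal_iff) auto
  then have "X \<longlonglongrightarrow> x" by (rule tendsto_dist_iff[THEN iffD2])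
  then have "(\<lambda>k. fst (X k)) \<longlonglongrightarrow> fst x" by (rule tendsto_fst)
  moreover have "(\<lambda>k. fst (X k)) \<longlonglongrightarrow> y + l *\<^sub>R d" unfolding X_def fst_conv by (intro tendsto_intros lim)
  ultimately have "fst x = y + l *\<^sub>R d" by (rule LIMSEQ_unique)
  then show ?thesis using that x(1) by (metis prod.collapse)
qed

section \<open>Complete hypersurfaces with spherical image in the lower hemisphere\<close>

text \<open>
  All normals point downwards, so \<open>M\<close> will be a graph over an open subset of \<open>real^'n\<close>.
\<close>

locale complete_downward_hypersurface = strictly_convex_C2_hypersurface M
  for M :: "((real^'n) \<times> real) set" +
  assumes complete: "complete_hypersurface M" and nonempty: "M \<noteq> {}"
    and down: "x \<in> M \<Longrightarrow> snd (N x) < 0"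
    and tangent_below_0: "x \<in> M \<Longrightarrow> 0 \<le> N x \<bullet> x"
begin

definition \<Omega> :: "(real^'n) set" where "\<Omega> = fst ` M"
definition u :: "real^'n \<Rightarrow> real" where "u y = (THE z. (y, z) \<in> M)"
definition X :: "real^'n \<Rightarrow> (real^'n) \<times> real" where "X y = (y, u y)"
text \<open>
  The slope of the hyperplane with normal \<open>\<xi>\<close>; on the lower hemisphere this is the gnomonic chart.
\<close>

definition slope :: "(real^'n) \<times> real \<Rightarrow> real^'n" where "slope \<xi> = (- 1 / snd \<xi>) *\<^sub>R fst \<xi>"
definition \<eta> :: "real^'n \<Rightarrow> real^'n" where "\<eta> y = slope (N (X y))"

text \<open>
  Of two points of \<open>M\<close> on a vertical line, each would have to lie above the other.
\<close>

lemma vertical_unique: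
  assumes "(y, z) \<in> M" "(y, z') \<in> M"
  shows "z = z'"
proof (rule ccontr)
  assume "z \<noteq> z'"
  then have "N (y, z) \<bullet> ((y, z') - (y, z)) < 0" "N (y, z') \<bullet> ((y, z) - (y, z')) < 0"
    using \<open>z \<noteq> z'\<close> gauss_map_props(2)[OF assms] gauss_map_props(2)[OF assms(2,1)] by simp_all
  then have "snd (N (y, z)) * (z' - z) < 0" "snd (N (y, z')) * (z - z') < 0"
    by (simp_all add: inner_prod_def)
  then show False using down[OF assms(1)] down[OF assms(2)] by (auto simp: mult_less_0_iff)
qed

lemma X_mem: "y \<in> \<Omega> \<Longrightarrow> X y \<in> M"
  unfolding \<Omega>_def X_def u_def using vertical_unique by (auto intro: theI)

lemma u_eq: "(y, z) \<in> M \<Longrightarrow> u y = z"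
  unfolding u_def using vertical_unique by blast

lemma mem_iff: "x \<in> M \<longleftrightarrow> (\<exists>y\<in>\<Omega>. x = X y)"
proof
  assume "x \<in> M"
  then have "fst x \<in> \<Omega>" "u (fst x) = snd x" using u_eq[of "fst x" "snd x"] by (auto simp: \<Omega>_def)
  then show "\<exists>y\<in>\<Omega>. x = X y" by (metis X_def prod.collapse)
qed (use X_mem in auto)

lemma normal_inner:
  assumes "y \<in> \<Omega>"
  shows "N (X y) \<bullet> (v, t) = - snd (N (X y)) * (\<eta> y \<bullet> v - t)"
  using down[OF X_mem[OF assms]] by (simp add: inner_prod_def \<eta>_def slope_def field_simps)

lemma strict_support:
  assumes "y \<in> \<Omega>" "y' \<in> \<Omega>" "y' \<noteq> y"
  shows "u y + \<eta> y \<bullet> (y' - y) < u y'"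
proof -
  have "N (X y) \<bullet> (X y' - X y) < 0"
    using assms X_mem by (intro gauss_map_props(2)) (auto simp: X_def)
  then have "- snd (N (X y)) * (\<eta> y \<bullet> (y' - y) - (u y' - u y)) < 0"
    using normal_inner[OF assms(1), of "y' - y" "u y' - u y"] by (simp add: X_def)
  then show ?thesis using down[OF X_mem[OF assms(1)]] by (auto simp: zero_less_mult_iff)
qed

text \<open>
  The normal is not horizontal, so a defining function of \<open>M\<close> changes its sign along the vertical line
  through a point of \<open>M\<close>, and by continuity along the neighbouring vertical lines.
\<close>

lemma open_domain: "open \<Omega>"
  unfolding open_contains_ball
proof
  fix y assume "y \<in> \<Omega>"
  then have x: "X y \<in> M" by (rule X_mem)
  obtain U g G \<sigma> V where l: "local_defining_function M U g" "open V" "X y \<in> V" "V \<subseteq> U" "\<sigma> = 1 \<or> \<sigma> = (-1::real)"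
    "\<And>y. y \<in> U \<Longrightarrow> GDERIV g y :> G y" "\<And>y. y \<in> M \<inter> V \<Longrightarrow> N y = \<sigma> *\<^sub>R sgn (G y)"
    using local_frame[OF x] by metis
  obtain gc: "open U" "M \<inter> U = {x \<in> U. g x = 0}" "continuous_on U g"
    using local_defining_functionD[OF l(1)] by metis
  have xU: "X y \<in> U" using l by blast
  then have g0: "g (X y) = 0" using gc(2) x by blast
  define e :: "(real^'n) \<times> real" where "e = (0, 1)"
  have Xe: "X y + s *\<^sub>R e = (y, u y + s)" for s by (simp add: X_def e_def)
  define k where "k = sgn (e \<bullet> G (X y))"
  have "e \<bullet> N (X y) \<noteq> 0" using down[OF x] by (simp add: e_def inner_prod_def)
  then have eG: "e \<bullet> G (X y) \<noteq> 0" using l(7)[of "X y"] x l(3) by (auto simp: sgn_div_norm)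
  have "((\<lambda>s. k * g (X y + s *\<^sub>R e)) has_real_derivative k * (e \<bullet> G (X y))) (at 0)"
    by (intro DERIV_cmult has_derivative_along_line l(6) xU)
  then have d: "((\<lambda>s. k * g (y, u y + s)) has_real_derivative k * (e \<bullet> G (X y))) (at 0)"
    by (simp add: Xe)
  have kpos: "k * (e \<bullet> G (X y)) > 0" using eG by (simp add: k_def sgn_if)
  have g0': "g (y, u y) = 0" using g0 by (simp add: X_def)
  obtain d1 where d1: "d1 > 0" "\<And>s. 0 < s \<Longrightarrow> s < d1 \<Longrightarrow> 0 < k * g (y, u y + s)"
    using DERIV_pos_inc_right[OF d kpos] g0' by auto
  obtain d2 where d2: "d2 > 0" "\<And>s. 0 < s \<Longrightarrow> s < d2 \<Longrightarrow> k * g (y, u y - s) < 0"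
    using DERIV_pos_inc_left[OF d kpos] g0' by auto
  obtain r where r: "r > 0" "ball (X y) r \<subseteq> U" using gc(1) xU by (meson open_contains_ball)
  define s where "s = min (min d1 d2) r / 2"
  have s: "s > 0" "s < d1" "s < d2" "s < r" using d1 d2 r by (auto simp: s_def)
  have inU: "(y', u y + t) \<in> U" if "dist y' y < r - s" "\<bar>t\<bar> \<le> s" for y' t
  proof -
    have "dist (X y) (y', u y + t) \<le> dist y y' + dist (u y) (u y + t)"
      unfolding X_def dist_Pair_Pair by (rule sqrt_sum_squares_le_sum) auto
    also have "\<dots> < r" using that by (simp add: dist_commute dist_real_def)
    finally show ?thesis using r(2) by auto
  qed
  have top: "eventually (\<lambda>y'. 0 < k * g (y', u y + s)) (nhds y)"
    and bot: "eventually (\<lambda>y'. k * g (y', u y - s) < 0) (nhds y)"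
  proof -
    have "isCont (\<lambda>y'. k * g (y', u y + t)) y" if "\<bar>t\<bar> \<le> s" for t
    proof -
      have "isCont g (y, u y + t)"
        using gc(1,3) inU[of y t] that s by (simp add: continuous_on_eq_continuous_at)
      then have "isCont (\<lambda>y'. g (y', u y + t)) y"
        by (intro isCont_o2[where f = "\<lambda>y'. (y', u y + t)" and g = g]) (auto intro!: continuous_intros)
      then show ?thesis by (intro continuous_intros)
    qed
    then have "((\<lambda>y'. k * g (y', u y + t)) \<longlongrightarrow> k * g (y, u y + t)) (nhds y)" if "\<bar>t\<bar> \<le> s" for t
      using that unfolding isCont_def by (intro tendsto_at_iff_tendsto_nhds[THEN iffD1]) auto
    from this[of s] this[of "-s"] show
      "eventually (\<lambda>y'. 0 < k * g (y', u y + s)) (nhds y)"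
      "eventually (\<lambda>y'. k * g (y', u y - s) < 0) (nhds y)"
      using order_tendstoD d1(2)[OF s(1,2)] d2(2)[OF s(1,3)] s(1) by force+
  qed
  then have "eventually (\<lambda>y'. 0 < k * g (y', u y + s) \<and> k * g (y', u y - s) < 0) (nhds y)"
    by (rule eventually_conj)
  then obtain d3 where d3: "d3 > 0" "\<And>y'. dist y' y < d3 \<Longrightarrow> 0 < k * g (y', u y + s) \<and> k * g (y', u y - s) < 0"
    unfolding eventually_nhds_metric by blast
  have "y' \<in> \<Omega>" if y': "dist y' y < min d3 (r - s)" for y'
  proof -
    have "continuous_on {-s..s} (\<lambda>t. k * g (y', u y + t))"
      by (intro continuous_on_mult_left continuous_on_compose2[OF gc(3)])
         (use inU y' in \<open>auto intro!: continuous_intros\<close>)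
    then obtain t where t: "-s \<le> t" "t \<le> s" "k * g (y', u y + t) = 0"
      using IVT'[of "\<lambda>t. k * g (y', u y + t)" "-s" 0 s] d3(2)[of y'] y' s(1) by force
    then have "g (y', u y + t) = 0" using kpos by auto
    moreover have "(y', u y + t) \<in> U" using inU t y' by auto
    ultimately have "(y', u y + t) \<in> M" using gc(2) by blast
    then show ?thesis unfolding \<Omega>_def by force
  qed
  then show "\<exists>e>0. ball y e \<subseteq> \<Omega>"
    using d3(1) s(4) by (intro exI[of _ "min d3 (r - s)"]) (auto simp: dist_commute)
qed

lemma continuous_height: "continuous_on \<Omega> u"
  by (rule continuous_on_if_subgradients[OF open_domain, where \<eta> = \<eta>])
     (metis strict_support less_imp_le diff_self inner_zero_right add_0_right order_refl)

lemma domain_no_escape: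
  assumes l: "0 < l" and d: "\<And>s. 0 \<le> s \<Longrightarrow> s < l \<Longrightarrow> y + s *\<^sub>R d \<in> \<Omega>"
    and C: "\<And>s. 0 \<le> s \<Longrightarrow> s < l \<Longrightarrow> u (y + s *\<^sub>R d) \<le> C"
  shows "y + l *\<^sub>R d \<in> \<Omega>"
proof -
  obtain z where "(y + l *\<^sub>R d, z) \<in> M"
  proof (rule complete_graph_no_escape[OF complete l, where y = y and d = d and \<phi> = "\<lambda>s. u (y + s *\<^sub>R d)"
        and m = "\<lambda>s. \<eta> (y + s *\<^sub>R d) \<bullet> d" and C = C])
    fix s t assume *: "s \<in> {0..<l}" "t \<in> {0..<l}"
    have "y + t *\<^sub>R d - (y + s *\<^sub>R d) = (t - s) *\<^sub>R d" by (simp add: algebra_simps)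
    then show "u (y + s *\<^sub>R d) + \<eta> (y + s *\<^sub>R d) \<bullet> d * (t - s) \<le> u (y + t *\<^sub>R d)"
      using strict_support[of "y + s *\<^sub>R d" "y + t *\<^sub>R d"] d * 
      by (cases "y + t *\<^sub>R d = y + s *\<^sub>R d") (auto simp: mult.commute)
  next
    show "continuous_on {0..<l} (\<lambda>s. u (y + s *\<^sub>R d))"
      by (rule continuous_on_compose2[OF continuous_height]) (use d in \<open>auto intro!: continuous_intros\<close>)
  qed (use d C X_mem in \<open>auto simp: X_def\<close>)
  then show ?thesis unfolding \<Omega>_def by force
qed

sublocale complete_convex_graph \<Omega> u \<eta>
proof
  show "u y - \<eta> y \<bullet> y \<le> 0" if "y \<in> \<Omega>" for y
  proof -
    have "0 \<le> N (X y) \<bullet> (y, u y)" using tangent_below_0[OF X_mem[OF that]] by (simp add: X_def)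
    then show ?thesis
      unfolding normal_inner[OF that] using down[OF X_mem[OF that]] by (auto simp: mult_le_0_iff)
  qed
  show "\<Omega> \<noteq> {}" using nonempty by (simp add: \<Omega>_def)
qed (fact open_domain strict_support domain_no_escape)+

lemma continuous_X: "continuous_on \<Omega> X"
  unfolding X_def[abs_def] by (intro continuous_intros continuous_u)

lemma continuous_normal: "continuous_on \<Omega> (\<lambda>y. N (X y))"
  by (rule continuous_on_compose2[OF continuous_gauss_map continuous_X]) (use X_mem in auto)

lemma continuous_\<eta>: "continuous_on \<Omega> \<eta>"
  unfolding \<eta>_def[abs_def] slope_def[abs_def]
  by (intro continuous_intros continuous_normal) (use down X_mem in fastforce)

lemma inj_\<eta>: "inj_on \<eta> \<Omega>"
proof (rule inj_onI, rule ccontr)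
  fix x y assume *: "x \<in> \<Omega>" "y \<in> \<Omega>" "\<eta> x = \<eta> y" "x \<noteq> y"
  then show False using strict_support[of x y] strict_support[of y x] by (simp add: inner_diff_right)
qed

text \<open>
  The inverse Gauss map is obtained from the inverse of the gradient map \<open>\<eta>\<close>, which is continuous by
  invariance of domain.
\<close>

lemma continuous_inverse_gauss_map: "continuous_on (N ` M) (inverse_gauss_map M)"
proof -
  define j where "j = the_inv_into \<Omega> \<eta>"
  have j: "j (\<eta> y) = y" if "y \<in> \<Omega>" for y
    unfolding j_def by (rule the_inv_into_f_f[OF inj_\<eta> that])
  have cj: "continuous_on (\<eta> ` \<Omega>) j"
    by (rule continuous_on_inverse_open[OF open_dom continuous_\<eta> _ j]) auto
  have "M = X ` \<Omega>" using mem_iff by blast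
  then have "N ` M = N ` X ` \<Omega>" by (rule arg_cong)
  then have NM: "N ` M = (\<lambda>y. N (X y)) ` \<Omega>" unfolding image_image .
  have "continuous_on (N ` M) slope"
    unfolding slope_def[abs_def] by (intro continuous_intros) (use down in fastforce)
  then have "continuous_on (N ` M) (\<lambda>\<xi>. j (slope \<xi>))"
    by (rule continuous_on_compose2[OF cj]) (auto simp: NM \<eta>_def)
  then have "continuous_on (N ` M) (\<lambda>\<xi>. X (j (slope \<xi>)))"
    by (rule continuous_on_compose2[OF continuous_X]) (auto simp: NM j simp flip: \<eta>_def)
  then show ?thesis
    by (rule continuous_on_eq) (auto simp: NM j X_mem inverse_gauss_map simp flip: \<eta>_def)
qed

lemma support_function_bounded_below:
  assumes r: "0 < r" "cball 0 r \<subseteq> \<Omega>"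
  obtains c where "0 < c" "\<And>y. y \<in> \<Omega> \<Longrightarrow> r \<le> norm y \<Longrightarrow> c \<le> N (X y) \<bullet> X y"
proof -
  from legendre_bounded_below[OF continuous_\<eta> r] obtain c where c: "0 < c"
    "\<And>y. y \<in> \<Omega> \<Longrightarrow> r \<le> norm y \<Longrightarrow> c * (1 + norm (\<eta> y)) \<le> \<eta> y \<bullet> y - u y" by blast
  have "c \<le> N (X y) \<bullet> X y" if y: "y \<in> \<Omega>" "r \<le> norm y" for y
  proof -
    let ?n = "N (X y)"
    have s: "snd ?n < 0" using down X_mem y by blast
    have "fst ?n = (- snd ?n) *\<^sub>R \<eta> y" using s by (simp add: \<eta>_def slope_def)
    then have "norm (fst ?n) = - snd ?n * norm (\<eta> y)" using s by (metis abs_of_pos neg_0_less_iff_less norm_scaleR)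
    moreover have "1 \<le> norm (fst ?n) + norm (snd ?n)"
      using norm_gauss_map[OF X_mem[OF y(1)]] norm_Pair_le[of "fst ?n" "snd ?n"] by simp
    ultimately have "1 \<le> - snd ?n * (1 + norm (\<eta> y))" using s by (simp add: algebra_simps)
    then have "c * 1 \<le> c * (- snd ?n * (1 + norm (\<eta> y)))" using c(1) by (intro mult_left_mono) auto
    also have "\<dots> = - snd ?n * (c * (1 + norm (\<eta> y)))" by simp
    also have "\<dots> \<le> - snd ?n * (\<eta> y \<bullet> y - u y)" using s c(2)[OF y] by (intro mult_left_mono) auto
    also have "\<dots> = ?n \<bullet> X y" unfolding X_def[of y, THEN arg_cong[where f = "\<lambda>x. ?n \<bullet> x"]]
      by (rule normal_inner[OF y(1), symmetric])
    finally show ?thesis by simp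
  qed
  then show ?thesis using that c(1) by blast
qed

section \<open>Divergence of the curvature integral\<close>

text \<open>
  With respect to an orthonormal basis adapted to \<open>\<xi> = N x\<close>, the derivative \<open>T\<close> at \<open>t\<xi>\<close> maps the tangent
  space to itself by \<open>1/t\<close> times the inverse of the derivative of the Gauss map, and the \<open>\<xi>\<close>-component of
  \<open>T \<xi>\<close> is \<open>L (\<xi> \<bullet> v)\<close>. The factor \<open>2^n\<close> bounds \<open>(1/t)^n\<close>.
\<close>

lemma sweep_derivative:
  fixes \<beta> :: "'n idx \<Rightarrow> (real^'n) \<times> real"
  assumes \<beta>: "bij_betw \<beta> UNIV Basis" and x: "x \<in> M" and K: "gauss_curvature M x \<noteq> 0"
    and t: "1/2 < t" and L: "0 < L" and v: "norm v = 1"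
    and S: "\<And>w. w \<in> S \<Longrightarrow> sgn w \<in> N ` M"
  obtains T where
    "((\<lambda>w. inverse_gauss_map M (sgn w) + (L * norm w) *\<^sub>R v) has_derivative T) (at (t *\<^sub>R N x) within S)"
    "\<bar>det (\<chi> i j. \<beta> i \<bullet> T (\<beta> j))\<bar> \<le> L * 2 ^ CARD('n) * (1 / \<bar>gauss_curvature M x\<bar>)"
proof -
  define \<xi> where "\<xi> = N x"
  have n1: "norm \<xi> = 1" using norm_gauss_map[OF x] by (simp add: \<xi>_def)
  then have \<xi>0: "N x \<noteq> 0" by (auto simp: \<xi>_def)
  obtain b :: "'n \<Rightarrow> (real^'n) \<times> real" where b: "orthonormal b" "\<And>i. b i \<bullet> N x = 0"
    using exists_orthonormal_tangent_basis[OF \<xi>0] by blast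
  obtain B where B: "(inverse_gauss_map M has_derivative B) (at (N x) within N ` M)"
    "\<And>w. N x \<bullet> B w = 0" "det (\<chi> i j. b i \<bullet> B (b j)) = 1 / gauss_curvature M x"
    using inverse_gauss_map_derivative[OF strictly_convex_C2_hypersurface_axioms x K b continuous_inverse_gauss_map]
    by blast
  have lB: "linear B" using has_derivative_linear[OF B(1)] .
  define w where "w = t *\<^sub>R \<xi>"
  have w0: "w \<noteq> 0" and sw: "sgn w = \<xi>" and nw: "norm w = t"
    using t n1 by (auto simp: w_def sgn_scaleR sgn_div_norm)
  define T where "T = (\<lambda>h. B ((h - (\<xi> \<bullet> h) *\<^sub>R \<xi>) /\<^sub>R t) + (L * (h \<bullet> \<xi>)) *\<^sub>R v)"
  have "(sgn has_derivative (\<lambda>h. (h - (\<xi> \<bullet> h) *\<^sub>R \<xi>) /\<^sub>R t)) (at w within S)"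
    using has_derivative_sgn[OF w0] by (auto simp: sw nw intro: has_derivative_at_withinI)
  moreover have "(inverse_gauss_map M has_derivative B) (at (sgn w) within sgn ` S)"
    using B(1) S by (auto simp: sw \<xi>_def intro: has_derivative_subset)
  ultimately have 1: "((\<lambda>w. inverse_gauss_map M (sgn w)) has_derivative (\<lambda>h. B ((h - (\<xi> \<bullet> h) *\<^sub>R \<xi>) /\<^sub>R t))) (at w within S)"
    by (rule has_derivative_in_compose)
  have "(norm has_derivative (\<lambda>h. h \<bullet> \<xi>)) (at w within S)"
    using has_derivative_norm[OF w0] by (auto simp: sw intro: has_derivative_at_withinI)
  then have "((\<lambda>w. (L * norm w) *\<^sub>R v) has_derivative (\<lambda>h. (L * (h \<bullet> \<xi>)) *\<^sub>R v)) (at w within S)"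
    by (intro has_derivative_scaleR_left has_derivative_mult_right)
  with 1 have der: "((\<lambda>w. inverse_gauss_map M (sgn w) + (L * norm w) *\<^sub>R v) has_derivative T) (at w within S)"
    unfolding T_def by (rule has_derivative_add)
  have Tb: "T (b j) = (1 / t) *\<^sub>R B (b j)" for j
    using b(2)[of j] by (simp add: T_def \<xi>_def inner_commute linear_scale[OF lB] divide_inverse)
  have "det (\<chi> i j. \<beta> i \<bullet> T (\<beta> j)) = (\<xi> \<bullet> T \<xi>) * det (\<chi> i j. b i \<bullet> T (b j))"
    by (rule det_orthonormal_block[OF \<beta> b(1) n1 _ has_derivative_linear[OF der]])
       (use b(2) B(2) in \<open>simp_all add: Tb \<xi>_def\<close>)
  also have "\<xi> \<bullet> T \<xi> = L * (\<xi> \<bullet> v)"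
  proof -
    have "\<xi> \<bullet> \<xi> = 1" using n1 by (simp add: norm_eq_1)
    then show ?thesis by (simp add: T_def linear_0[OF lB])
  qed
  also have "det (\<chi> i j. b i \<bullet> T (b j)) = (1 / t) ^ CARD('n) * (1 / gauss_curvature M x)"
  proof -
    have "(\<chi> i j. b i \<bullet> T (b j)) = (\<chi> i. (1 / t) *s (\<chi> j. b i \<bullet> B (b j)))"
      by (simp add: vec_eq_iff Tb)
    then show ?thesis using det_rows_mul[of "\<lambda>_. 1 / t" "\<lambda>i. (\<chi> j. b i \<bullet> B (b j)) :: real^'n"] B(3) by simp
  qed
  finally have "\<bar>det (\<chi> i j. \<beta> i \<bullet> T (\<beta> j))\<bar> = L * \<bar>\<xi> \<bullet> v\<bar> * ((1 / t) ^ CARD('n) * (1 / \<bar>gauss_curvature M x\<bar>))"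
    using L t by (simp add: abs_mult power_abs)
  also have "\<dots> \<le> L * 1 * (2 ^ CARD('n) * (1 / \<bar>gauss_curvature M x\<bar>))"
  proof (intro mult_mono mult_left_mono mult_right_mono)
    show "\<bar>\<xi> \<bullet> v\<bar> \<le> 1" using Cauchy_Schwarz_ineq2[of \<xi> v] n1 v by simp
    show "(1 / t) ^ CARD('n) \<le> 2 ^ CARD('n)" using t by (intro power_mono) (auto simp: field_simps)
  qed (use L t in auto)
  finally show ?thesis using that[of T] der by (simp add: w_def \<xi>_def mult.assoc)
qed

text \<open>
  By \<open>low\<close> the Jacobian of the sweeping map is at most a constant times \<open>L f\<close>, so the swept region has
  volume at most a constant times \<open>L\<close>; but the boxes in it have volume about \<open>\<kappa> m L / 2\<close> for every \<open>m\<close>.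
\<close>

lemma curvature_density_not_integrable:
  assumes f: "set_integrable (completion sphere_measure) (N ` M) f"
    and low: "\<And>r. 0 < r \<Longrightarrow> cball 0 r \<subseteq> \<Omega> \<Longrightarrow>
      \<exists>c>0. \<forall>y\<in>\<Omega>. r \<le> norm y \<longrightarrow> c \<le> f (N (X y)) * \<bar>gauss_curvature M (X y)\<bar>"
  shows False
proof -
  obtain r \<omega> \<kappa> where r: "0 < r" "cball 0 r \<subseteq> \<Omega>" and \<omega>: "norm \<omega> = 1" and \<kappa>: "0 < \<kappa>"
    and box: "\<And>m. 0 < m \<Longrightarrow> \<exists>S>0. \<forall>L\<ge>2 * S. \<exists>E\<in>sets borel. emeasure lborel E = ennreal (\<kappa> * m * (L / 2 - S)) \<and>
        E \<subseteq> {(y + (L * t) *\<^sub>R \<omega>, u y) | y t. y \<in> \<Omega> \<and> r \<le> norm y \<and> 1/2 < t \<and> t < 1}"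
    by (rule large_boxes_beyond_graph) (rule that)
  obtain c where c: "c > 0" "\<And>y. y \<in> \<Omega> \<Longrightarrow> r \<le> norm y \<Longrightarrow> c \<le> f (N (X y)) * \<bar>gauss_curvature M (X y)\<bar>"
    using low[OF r] by blast
  define P where "P = ({1/2<..<1::real} \<times> \<Omega>) \<inter> (UNIV \<times> {y. r \<le> norm y})"
  define S where "S = (\<lambda>(t, y). t *\<^sub>R N (X y)) ` P"
  have S: "S \<in> sets borel"
    unfolding S_def P_def
  proof (rule borel_continuous_image_open_Int_closed)
    show "open ({1/2<..<1::real} \<times> \<Omega>)" by (intro open_Times open_dom) auto
    show "closed (UNIV \<times> {y::real^'n. r \<le> norm y} :: (real \<times> (real^'n)) set)"
      by (intro closed_Times closed_Collect_le continuous_intros closed_UNIV)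
    show "continuous_on ({1/2<..<1::real} \<times> \<Omega> \<inter> UNIV \<times> {y. r \<le> norm y}) (\<lambda>(t, y). t *\<^sub>R N (X y))"
      unfolding case_prod_unfold
      by (intro continuous_intros continuous_on_compose2[OF continuous_normal]) auto
  qed
  have Selem: "\<exists>t y. w = t *\<^sub>R N (X y) \<and> 1/2 < t \<and> t < 1 \<and> y \<in> \<Omega> \<and> r \<le> norm y" if "w \<in> S" for w
  proof -
    obtain q where "q \<in> P" "w = fst q *\<^sub>R N (X (snd q))" using \<open>w \<in> S\<close> by (auto simp: S_def)
    then show ?thesis by (intro exI[of _ "fst q"] exI[of _ "snd q"]) (auto simp: P_def)
  qed
  have nN: "norm (N (X y)) = 1" if "y \<in> \<Omega>" for y using norm_gauss_map[OF X_mem[OF that]] .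
  have sgnS: "sgn (t *\<^sub>R N (X y)) = N (X y)" if "0 < t" "y \<in> \<Omega>" for t y
    using that nN by (simp add: sgn_scaleR sgn_div_norm)
  have Ssgn: "sgn w \<in> N ` M" and Sball': "w \<in> ball 0 1" if w: "w \<in> S" for w
  proof -
    obtain t y where ty: "w = t *\<^sub>R N (X y)" "1/2 < t" "t < 1" "y \<in> \<Omega>" using Selem[OF w] by blast
    then have "sgn w = N (X y)" using sgnS[of t y] by simp
    then show "sgn w \<in> N ` M" using X_mem[OF ty(4)] by blast
    show "w \<in> ball 0 1" using ty nN[of y] by simp
  qed
  have Sball: "S \<subseteq> ball 0 1" using Sball' by blast
  have fS: "set_integrable lebesgue S (\<lambda>w. f (sgn w))"
    by (rule set_integrable_cone_over_sphere[OF f S Sball Ssgn])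
  define I where "I = (LINT w:S|lebesgue. f (sgn w))"
  define C where "C = 2 ^ CARD('n) / c * I"
  have "CARD('n idx) = card (Basis :: ((real^'n) \<times> real) set)" by (simp add: card_idx)
  then obtain \<beta> :: "'n idx \<Rightarrow> (real^'n) \<times> real" where \<beta>: "bij_betw \<beta> UNIV Basis"
    by (metis finite finite_Basis finite_same_card_bij)
  have vol: "emeasure lborel E \<le> ennreal (L * C)" if L: "L > 0" and E: "E \<in> sets borel"
    "E \<subseteq> {(y + (L * t) *\<^sub>R \<omega>, u y) | y t. y \<in> \<Omega> \<and> r \<le> norm y \<and> 1/2 < t \<and> t < 1}" for L E
  proof -
    define \<Theta> where "\<Theta> w = inverse_gauss_map M (sgn w) + (L * norm w) *\<^sub>R (\<omega>, 0)" for w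
    define k where "k = L * 2 ^ CARD('n) / c"
    have "\<exists>T. (\<Theta> has_derivative T) (at w within S) \<and> \<bar>det (\<chi> i j. \<beta> i \<bullet> T (\<beta> j))\<bar> \<le> k * f (sgn w)" if w: "w \<in> S" for w
    proof -
      obtain t y where ty: "w = t *\<^sub>R N (X y)" "1/2 < t" "t < 1" "y \<in> \<Omega>" "r \<le> norm y" using Selem[OF w] by blast
      let ?K = "\<bar>gauss_curvature M (X y)\<bar>"
      have cK: "c \<le> f (N (X y)) * ?K" using c(2) ty by blast
      then have K: "gauss_curvature M (X y) \<noteq> 0" using c(1) by auto
      then have "1 / ?K \<le> f (N (X y)) / c" using cK c(1) by (simp add: field_simps)
      then have "L * 2 ^ CARD('n) * (1 / ?K) \<le> L * 2 ^ CARD('n) * (f (N (X y)) / c)"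
        using L by (intro mult_left_mono) auto
      also have "\<dots> = k * f (sgn w)" using ty sgnS[of t y] by (simp add: k_def)
      finally have b: "L * 2 ^ CARD('n) * (1 / ?K) \<le> k * f (sgn w)" .
      have "norm (\<omega>, 0::real) = 1" using \<omega> by (simp add: norm_Pair)
      from sweep_derivative[OF \<beta> X_mem[OF ty(4)] K ty(2) L this Ssgn]
      obtain T where "(\<Theta> has_derivative T) (at w within S)"
        "\<bar>det (\<chi> i j. \<beta> i \<bullet> T (\<beta> j))\<bar> \<le> L * 2 ^ CARD('n) * (1 / ?K)"
        unfolding \<Theta>_def[abs_def] ty(1) by blast
      then show ?thesis using b by (intro exI[of _ T]) auto
    qed
    then obtain T where T: "\<And>w. w \<in> S \<Longrightarrow> (\<Theta> has_derivative T w) (at w within S)"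
      "\<And>w. w \<in> S \<Longrightarrow> \<bar>det (\<chi> i j. \<beta> i \<bullet> T w (\<beta> j))\<bar> \<le> k * f (sgn w)" by metis
    have "E \<subseteq> \<Theta> ` S"
    proof
      fix x assume "x \<in> E"
      then obtain y t where yt: "x = (y + (L * t) *\<^sub>R \<omega>, u y)" "y \<in> \<Omega>" "r \<le> norm y" "1/2 < t" "t < 1"
        using E(2) by blast
      let ?w = "t *\<^sub>R N (X y)"
      have "(t, y) \<in> P" using yt by (simp add: P_def)
      then have "?w \<in> S" unfolding S_def by (rule rev_image_eqI) simp
      moreover have "\<Theta> ?w = x"
        using yt sgnS[of t y] nN inverse_gauss_map[OF X_mem[OF yt(2)]]
        by (simp add: \<Theta>_def) (simp add: X_def)
      ultimately show "x \<in> \<Theta> ` S" by blast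
    qed
    from emeasure_differentiable_image_le[OF \<beta> S T _ E(1) this]
    have "emeasure lborel E \<le> ennreal (LINT w:S|lebesgue. k * f (sgn w))"
      using fS by (simp add: set_integrable_mult_right)
    also have "(LINT w:S|lebesgue. k * f (sgn w)) = L * C"
      by (simp add: k_def C_def I_def)
    finally show ?thesis .
  qed
  \<comment> \<open>With this \<open>m\<close> the box has volume \<open>4 * (\<bar>C\<bar> + 1) * (L / 2 - S0)\<close>, which for \<open>L = 8 * S0\<close> is more than \<open>L * C\<close>.\<close>
  define m where "m = 4 * (\<bar>C\<bar> + 1) / \<kappa>"
  have m: "m > 0" "\<kappa> * m = 4 * (\<bar>C\<bar> + 1)" using \<kappa> by (auto simp: m_def)
  obtain S0 where S0: "S0 > 0" "\<And>L. L \<ge> 2 * S0 \<Longrightarrow> \<exists>E\<in>sets borel. emeasure lborel E = ennreal (\<kappa> * m * (L / 2 - S0)) \<and>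
        E \<subseteq> {(y + (L * t) *\<^sub>R \<omega>, u y) | y t. y \<in> \<Omega> \<and> r \<le> norm y \<and> 1/2 < t \<and> t < 1}"
    using box[OF m(1)] by blast
  define L where "L = 8 * S0"
  have L: "L > 0" "L \<ge> 2 * S0" using S0(1) by (auto simp: L_def)
  obtain E where E: "E \<in> sets borel" "emeasure lborel E = ennreal (\<kappa> * m * (L / 2 - S0))"
    "E \<subseteq> {(y + (L * t) *\<^sub>R \<omega>, u y) | y t. y \<in> \<Omega> \<and> r \<le> norm y \<and> 1/2 < t \<and> t < 1}"
    using S0(2)[OF L(2)] by (elim bexE conjE)
  have "ennreal (\<kappa> * m * (L / 2 - S0)) \<le> ennreal (L * C)"
    using vol[OF L(1) E(1,3)] unfolding E(2) .
  also have "\<dots> \<le> ennreal (L * \<bar>C\<bar>)" using L(1) by (intro ennreal_leI mult_left_mono) auto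
  finally have "\<kappa> * m * (L / 2 - S0) \<le> L * \<bar>C\<bar>" using L(1) by (subst (asm) ennreal_le_iff) auto
  then have "12 * ((\<bar>C\<bar> + 1) * S0) \<le> 8 * (S0 * \<bar>C\<bar>)" by (simp add: m(2) L_def algebra_simps)
  moreover have "S0 * \<bar>C\<bar> \<ge> 0" using S0(1) by simp
  ultimately show False using S0(1) by (simp add: algebra_simps)
qed

end

text \<open>
  A power of a negative real number is that of its absolute value. Therefore the equation bounds \<open>\<bar>K\<bar>\<close> from
  below whatever the sign of \<open>K\<close> is.
\<close>

lemma powr_abs: "\<bar>x::real\<bar> powr a = x powr a"
  by (simp add: powr_def abs_if ln_minus)

theorem lemma3p1:
  fixes p :: real
    and D :: "((real^'n) \<times> real) set"
    and f :: "(real^'n) \<times> real \<Rightarrow> real"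
  assumes "p < 1"
    and "D \<subseteq> lower_hemisphere"
    and "set_integrable (completion sphere_measure) D f"
    and "\<forall>\<xi>\<in>D. f \<xi> \<ge> 0"
  shows "\<not> (\<exists>M :: ((real^'n) \<times> real) set.
            C2_hypersurface M \<and> strictly_convex_hypersurface M \<and>
            complete_hypersurface M \<and> \<not> compact M \<and>
            spherical_image M = D \<and>
            (\<forall>\<xi>\<in>D. support_function M \<xi> =
                (f \<xi> * gauss_curvature M (inverse_gauss_map M \<xi>)) powr (1 / (1 - p))))"
proof
  assume "\<exists>M :: ((real^'n) \<times> real) set.
            C2_hypersurface M \<and> strictly_convex_hypersurface M \<and>
            complete_hypersurface M \<and> \<not> compact M \<and>
            spherical_image M = D \<and>
            (\<forall>\<xi>\<in>D. support_function M \<xi> =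
                (f \<xi> * gauss_curvature M (inverse_gauss_map M \<xi>)) powr (1 / (1 - p)))"
  then obtain M :: "((real^'n) \<times> real) set" where M: "C2_hypersurface M" "strictly_convex_hypersurface M"
      "complete_hypersurface M" "\<not> compact M" and D: "gauss_map M ` M = D"
    and eq: "\<And>\<xi>. \<xi> \<in> D \<Longrightarrow> support_function M \<xi> =
          (f \<xi> * gauss_curvature M (inverse_gauss_map M \<xi>)) powr (1 / (1 - p))"
    unfolding spherical_image_def by blast
  interpret strictly_convex_C2_hypersurface M
    by unfold_locales (use M in auto)
  have H: "N x \<bullet> x = \<bar>f (N x) * gauss_curvature M x\<bar> powr (1 / (1 - p))" if "x \<in> M" for x
    using eq[of "N x"] that D by (auto simp: support_function_def inverse_gauss_map powr_abs)
  interpret complete_downward_hypersurface M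
  proof
    show "M \<noteq> {}" using M(4) by auto
    show "snd (N x) < 0" if "x \<in> M" for x
      using assms(2) D that by (auto simp: lower_hemisphere_def)
    show "0 \<le> N x \<bullet> x" if "x \<in> M" for x using H[OF that] by simp
  qed (rule M(3))
  show False
  proof (rule curvature_density_not_integrable)
    show "set_integrable (completion sphere_measure) (N ` M) f" using assms(3) D by simp
    fix r :: real assume "0 < r" "cball 0 r \<subseteq> \<Omega>"
    from support_function_bounded_below[OF this] obtain c where c: "c > 0"
      "\<And>y. y \<in> \<Omega> \<Longrightarrow> r \<le> norm y \<Longrightarrow> c \<le> N (X y) \<bullet> X y" by blast
    have "c powr (1 - p) \<le> f (N (X y)) * \<bar>gauss_curvature M (X y)\<bar>" if y: "y \<in> \<Omega>" "r \<le> norm y" for y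
    proof -
      let ?q = "\<bar>f (N (X y)) * gauss_curvature M (X y)\<bar>"
      have "c \<le> ?q powr (1 / (1 - p))" using c(2)[OF y] H[OF X_mem[OF y(1)]] by simp
      then have "c powr (1 - p) \<le> (?q powr (1 / (1 - p))) powr (1 - p)"
        using c(1) assms(1) by (intro powr_mono2) auto
      also have "\<dots> = ?q" using assms(1) by (simp add: powr_powr)
      also have "\<dots> = f (N (X y)) * \<bar>gauss_curvature M (X y)\<bar>"
        using assms(4) D X_mem[OF y(1)] by (auto simp: abs_mult)
      finally show ?thesis .
    qed
    then show "\<exists>c>0. \<forall>y\<in>\<Omega>. r \<le> norm y \<longrightarrow> c \<le> f (N (X y)) * \<bar>gauss_curvature M (X y)\<bar>"
      using c(1) by (intro exI[of _ "c powr (1 - p)"]) auto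
  qed
qed

end
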